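(* Let $\Bbbk$ be an algebraically closed field of characteristic zero, let $A=\Bbbk[x,y,z]$ be graded by $\deg x=a$, $\deg y=b$, $\deg z=c$ with $a,b,c$ positive integers, and let $\Omega\in A$ be a nonzero homogeneous element of degree $a+b+c$. Then $rgt(A_\Omega)=0$ if and only if $\Omega$ is irreducible.
   Context: $A_\Omega$ denotes $A=\Bbbk[x,y,z]$ with the Poisson bracket $\{f,g\}=\det\frac{\partial(f,g,\Omega)}{\partial(x,y,z)}$ (so $\{x,y\}=\Omega_z$, $\{y,z\}=\Omega_x$, $\{z,x\}=\Omega_y$); write $\pi$ for the corresponding bivector. Since $\deg\Omega=a+b+c$, the bracket is homogeneous of degree $0$. The Euler derivation $E$ of $A$ is $E(f)=\deg(f)f$ for homogeneous $f$. A derivation $\delta$ of $A$ is semi-Poisson if $E\wedge[\delta,\pi]_S=0$, where $[-,-]_S$ is the Schouten bracket on skew-symmetric multiderivations and $(P\wedge Q)$ is the wedge product of multiderivations; equivalently, $\pi+E\wedge\delta$ satisfies $[E\wedge\delta,\pi]_S=0$. $Gspd(A)$ is the $\Bbbk$-vector space of semi-Poisson derivations of $A$ that are homogeneous of degree $0$. The rigidity of $A$ is $rgt(A):=1-\dim_\Bbbk Gspd(A)$. *)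

theory Defs
  imports
    "HOL-Analysis.Determinants"
    "HOL-Library.Function_Algebras"
    "HOL-Computational_Algebra.Polynomial_Factorial"
begin

text \<open>
  The ring \<open>k[x,y,z]\<close> is realised as \<open>k[x][y][z]\<close>: the coefficient of
  \<open>x ^ i * y ^ j * z ^ l\<close> in \<open>f\<close> is \<open>coeff (coeff (coeff f l) j) i\<close>.
\<close>

type_synonym 'k poly3 = "'k poly poly poly"

definition X3 :: "'k::comm_ring_1 poly3" where "X3 = [:[:[:0, 1:]:]:]"
definition Y3 :: "'k::comm_ring_1 poly3" where "Y3 = [:[:0, 1:]:]"
definition Z3 :: "'k::comm_ring_1 poly3" where "Z3 = [:0, 1:]"

definition scale3 :: "'k::comm_ring_1 \<Rightarrow> 'k poly3 \<Rightarrow> 'k poly3" where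
  "scale3 c f = smult [:[:c:]:] f"

definition dx :: "'k::field poly3 \<Rightarrow> 'k poly3" where "dx = map_poly (map_poly pderiv)"
definition dy :: "'k::field poly3 \<Rightarrow> 'k poly3" where "dy = map_poly pderiv"
definition dz :: "'k::field poly3 \<Rightarrow> 'k poly3" where "dz = pderiv"

text \<open>The zero polynomial is homogeneous of every degree.\<close>

definition homogeneous :: "nat \<Rightarrow> nat \<Rightarrow> nat \<Rightarrow> nat \<Rightarrow> 'k::field poly3 \<Rightarrow> bool" where
  "homogeneous a b c n f \<longleftrightarrow>
     (\<forall>i j l. coeff (coeff (coeff f l) j) i \<noteq> 0 \<longrightarrow> a * i + b * j + c * l = n)"

definition derivation :: "('k::field poly3 \<Rightarrow> 'k poly3) \<Rightarrow> bool" where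
  "derivation \<delta> \<longleftrightarrow> Vector_Spaces.linear scale3 scale3 \<delta> \<and>
     (\<forall>f g. \<delta> (f * g) = \<delta> f * g + f * \<delta> g)"

definition degree0_map ::
    "nat \<Rightarrow> nat \<Rightarrow> nat \<Rightarrow> ('k::field poly3 \<Rightarrow> 'k poly3) \<Rightarrow> bool" where
  "degree0_map a b c \<delta> \<longleftrightarrow>
     (\<forall>n f. homogeneous a b c n f \<longrightarrow> homogeneous a b c n (\<delta> f))"

text \<open>
  The Euler derivation. The lemmas \<open>euler_homogeneous\<close> and \<open>derivation_euler\<close> below
  show that this is the derivation with \<open>E f = deg f * f\<close> for homogeneous \<open>f\<close>.
\<close>

definition euler :: "nat \<Rightarrow> nat \<Rightarrow> nat \<Rightarrow> 'k::field poly3 \<Rightarrow> 'k poly3" where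
  "euler a b c f = of_nat a * X3 * dx f + of_nat b * Y3 * dy f + of_nat c * Z3 * dz f"

definition bracket :: "'k::field poly3 \<Rightarrow> 'k poly3 \<Rightarrow> 'k poly3 \<Rightarrow> 'k poly3" where
  "bracket \<Omega> f g =
     det (vector [vector [dx f, dy f, dz f],
                  vector [dx g, dy g, dz g],
                  vector [dx \<Omega>, dy \<Omega>, dz \<Omega>]] :: 'k poly3^3^3)"

text \<open>
  A multiderivation of arity \<open>p\<close> is a map on argument lists; only its values on lists
  of length \<open>p\<close> are meaningful. The wedge product and the Schouten bracket are given by
  sums over \<open>(p,q)\<close>-shuffles, with arguments indexed from 0:
  \[ (P \wedge Q)(f_1,\dots,f_{p+q}) = \sum_{\sigma \in S_{p,q}} sgn(\sigma)
     P(f_{\sigma(1)},\dots,f_{\sigma(p)}) Q(f_{\sigma(p+1)},\dots,f_{\sigma(p+q)}) \]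
  \[ [P,Q]_S(f_1,\dots,f_{p+q-1}) = \sum_{\sigma \in S_{q,p-1}} sgn(\sigma)
     P(Q(f_{\sigma(1)},\dots,f_{\sigma(q)}),f_{\sigma(q+1)},\dots,f_{\sigma(q+p-1)})
     - (-1)^{(p-1)(q-1)} \sum_{\sigma \in S_{p,q-1}} sgn(\sigma)
     Q(P(f_{\sigma(1)},\dots,f_{\sigma(p)}),f_{\sigma(p+1)},\dots,f_{\sigma(p+q-1)}) \]
  The Schouten bracket is meant for \<open>p, q \<ge> 1\<close>.
\<close>

type_synonym 'a multimap = "'a list \<Rightarrow> 'a"

definition shuffle_perms :: "nat \<Rightarrow> nat \<Rightarrow> (nat \<Rightarrow> nat) set" where
  "shuffle_perms p q =
     {\<sigma>. \<sigma> permutes {..<p + q} \<and> strict_mono_on {..<p} \<sigma> \<and> strict_mono_on {p..<p + q} \<sigma>}"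

definition wedge ::
    "nat \<Rightarrow> nat \<Rightarrow> 'a::comm_ring_1 multimap \<Rightarrow> 'a multimap \<Rightarrow> 'a multimap" where
  "wedge p q P Q fs =
     (\<Sum>\<sigma>\<in>shuffle_perms p q. of_int (sign \<sigma>) *
        (P (map (\<lambda>i. fs ! \<sigma> i) [0..<p]) * Q (map (\<lambda>i. fs ! \<sigma> i) [p..<p + q])))"

definition schouten ::
    "nat \<Rightarrow> nat \<Rightarrow> 'a::comm_ring_1 multimap \<Rightarrow> 'a multimap \<Rightarrow> 'a multimap" where
  "schouten p q P Q fs =
     (\<Sum>\<sigma>\<in>shuffle_perms q (p - 1). of_int (sign \<sigma>) *
        P (Q (map (\<lambda>i. fs ! \<sigma> i) [0..<q]) # map (\<lambda>i. fs ! \<sigma> i) [q..<q + (p - 1)]))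
     - (- 1) ^ ((p - 1) * (q - 1)) *
     (\<Sum>\<sigma>\<in>shuffle_perms p (q - 1). of_int (sign \<sigma>) *
        Q (P (map (\<lambda>i. fs ! \<sigma> i) [0..<p]) # map (\<lambda>i. fs ! \<sigma> i) [p..<p + (q - 1)]))"

definition vector_field :: "('a \<Rightarrow> 'a) \<Rightarrow> 'a multimap" where
  "vector_field \<delta> fs = \<delta> (fs ! 0)"

definition bivector :: "('a \<Rightarrow> 'a \<Rightarrow> 'a) \<Rightarrow> 'a multimap" where
  "bivector \<pi> fs = \<pi> (fs ! 0) (fs ! 1)"

definition semi_poisson ::
    "nat \<Rightarrow> nat \<Rightarrow> nat \<Rightarrow> 'k::field poly3 \<Rightarrow> ('k poly3 \<Rightarrow> 'k poly3) \<Rightarrow> bool" where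
  "semi_poisson a b c \<Omega> \<delta> \<longleftrightarrow> derivation \<delta> \<and>
     (\<forall>fs. length fs = 3 \<longrightarrow>
        wedge 1 2 (vector_field (euler a b c))
          (schouten 1 2 (vector_field \<delta>) (bivector (bracket \<Omega>))) fs = 0)"

definition Gspd ::
    "nat \<Rightarrow> nat \<Rightarrow> nat \<Rightarrow> 'k::field poly3 \<Rightarrow> ('k poly3 \<Rightarrow> 'k poly3) set" where
  "Gspd a b c \<Omega> = {\<delta>. semi_poisson a b c \<Omega> \<delta> \<and> degree0_map a b c \<delta>}"

definition scale_map :: "'k::field \<Rightarrow> ('k poly3 \<Rightarrow> 'k poly3) \<Rightarrow> ('k poly3 \<Rightarrow> 'k poly3)" where
  "scale_map r \<delta> = (\<lambda>f. scale3 r (\<delta> f))"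

text \<open>
  \<open>vector_space.dim\<close> is 0 on infinite-dimensional spaces. This does not interfere here:
  for positive weights \<open>Gspd\<close> is finite-dimensional, since a degree 0 derivation is
  determined by its values on \<open>x, y, z\<close>, which lie in finite-dimensional graded pieces.
\<close>

definition rgt :: "nat \<Rightarrow> nat \<Rightarrow> nat \<Rightarrow> 'k::field poly3 \<Rightarrow> int" where
  "rgt a b c \<Omega> = 1 - int (vector_space.dim scale_map (Gspd a b c \<Omega>))"

lemma vector_space_scale3: "vector_space (scale3 :: 'k::field \<Rightarrow> _)"
  by unfold_locales
    (simp_all add: scale3_def smult_add_right flip: smult_add_left one_pCons)

lemma vector_space_scale_map: "vector_space (scale_map :: 'k::field \<Rightarrow> _)"
proof -
  interpret vector_space "scale3 :: 'k \<Rightarrow> _" by (rule vector_space_scale3)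
  show ?thesis
    by unfold_locales (simp_all add: scale_map_def fun_eq_iff scale_right_distrib scale_left_distrib)
qed

lemma coeff_dx:
  "coeff (coeff (coeff (dx f) l) j) i = of_nat (Suc i) * coeff (coeff (coeff f l) j) (Suc i)"
  by (simp add: dx_def coeff_map_poly coeff_pderiv)

lemma coeff_dy:
  "coeff (coeff (coeff (dy f) l) j) i = of_nat (Suc j) * coeff (coeff (coeff f l) (Suc j)) i"
  by (simp add: dy_def coeff_map_poly coeff_pderiv of_nat_poly del: of_nat_Suc)

lemma coeff_dz:
  "coeff (coeff (coeff (dz f) l) j) i = of_nat (Suc l) * coeff (coeff (coeff f (Suc l)) j) i"
  by (simp add: dz_def coeff_pderiv of_nat_poly del: of_nat_Suc)

lemma poly3_eqI:
  "(\<And>l j i. coeff (coeff (coeff f l) j) i = coeff (coeff (coeff g l) j) i) \<Longrightarrow> f = g"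
  by (simp add: poly_eq_iff)

lemma dx_simps: "dx (X3 :: 'k::field poly3) = 1" "dx (Y3 :: 'k poly3) = 0" "dx (Z3 :: 'k poly3) = 0"
  by (simp_all add: dx_def X3_def Y3_def Z3_def map_poly_pCons pderiv_pCons one_pCons)

lemma dy_simps: "dy (X3 :: 'k::field poly3) = 0" "dy (Y3 :: 'k poly3) = 1" "dy (Z3 :: 'k poly3) = 0"
  by (simp_all add: dy_def X3_def Y3_def Z3_def map_poly_pCons pderiv_pCons one_pCons)

lemma dz_simps: "dz (X3 :: 'k::field poly3) = 0" "dz (Y3 :: 'k poly3) = 0" "dz (Z3 :: 'k poly3) = 1"
  by (simp_all add: dz_def X3_def Y3_def Z3_def pderiv_pCons one_pCons)

lemma bracket_generators:
  "bracket \<Omega> X3 Y3 = dz \<Omega>" "bracket \<Omega> Y3 Z3 = dx \<Omega>" "bracket \<Omega> Z3 X3 = dy \<Omega>"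
  by (simp_all add: bracket_def det_3 dx_simps dy_simps dz_simps)

lemma map_poly_mult_derivation:
  fixes d :: "'a::comm_ring_1 \<Rightarrow> 'a"
  assumes add: "\<And>f g. d (f + g) = d f + d g"
    and mult: "\<And>f g. d (f * g) = d f * g + f * d g"
  shows "map_poly d (f * g) = map_poly d f * g + f * map_poly d g"
proof -
  have d0: "d 0 = 0" using add[of 0 0] by simp
  have dsum: "d (sum h A) = (\<Sum>x\<in>A. d (h x))" for h :: "nat \<Rightarrow> 'a" and A
    by (induction A rule: infinite_finite_induct) (simp_all add: d0 add)
  show ?thesis
    by (rule poly_eqI) (simp add: coeff_map_poly d0 coeff_mult dsum mult sum.distrib)
qed

lemma map_poly_add_derivation:
  fixes d :: "'a::comm_ring_1 \<Rightarrow> 'a"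
  assumes add: "\<And>f g. d (f + g) = d f + d g"
  shows "map_poly d (f + g) = map_poly d f + map_poly d g"
proof -
  have d0: "d 0 = 0" using add[of 0 0] by simp
  show ?thesis by (rule poly_eqI) (simp add: coeff_map_poly d0 add)
qed

lemma d_add:
  "dx (f + g) = dx f + dx g" "dy (f + g) = dy f + dy g" "dz (f + g) = dz f + dz g"
  by (rule poly3_eqI; simp add: coeff_dx coeff_dy coeff_dz algebra_simps)+

lemma d_scale3:
  "dx (scale3 r f) = scale3 r (dx f)" "dy (scale3 r f) = scale3 r (dy f)"
  "dz (scale3 r f) = scale3 r (dz f)"
  by (rule poly3_eqI; simp add: coeff_dx coeff_dy coeff_dz scale3_def)+

lemma d_mult:
  "dx (f * g) = dx f * g + f * dx g" "dy (f * g) = dy f * g + f * dy g"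
  "dz (f * g) = dz f * g + f * dz g"
proof -
  have p: "pderiv (u * v) = pderiv u * v + u * pderiv v" for u v :: "'b::idom poly"
    by (simp add: pderiv_mult mult.commute add.commute)
  show "dx (f * g) = dx f * g + f * dx g" "dy (f * g) = dy f * g + f * dy g"
    "dz (f * g) = dz f * g + f * dz g"
    unfolding dx_def dy_def dz_def
    by (intro map_poly_mult_derivation map_poly_add_derivation pderiv_add p)+
qed

lemma derivation_euler: "derivation (euler a b c :: 'k::field poly3 \<Rightarrow> _)"
proof -
  have "module_hom scale3 scale3 (euler a b c :: 'k poly3 \<Rightarrow> _)"
    unfolding module_hom_def module_hom_axioms_def
    using vector_space_scale3[where ?'k = 'k]
    by (auto simp: module_iff_vector_space euler_def d_add d_scale3 distrib_left)
       (simp add: scale3_def smult_add_right)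
  then show ?thesis
    by (auto simp: derivation_def module_hom_iff_linear euler_def d_mult algebra_simps)
qed

lemma coeff_euler:
  "coeff (coeff (coeff (euler a b c f) l) j) i =
     of_nat (a * i + b * j + c * l) * coeff (coeff (coeff f l) j) i"
proof -
  have X: "coeff (coeff (coeff (X3 * g) l) j) i =
      (if i = 0 then 0 else coeff (coeff (coeff g l) j) (i - 1))" for g :: "'a poly3"
    by (cases i) (simp_all add: X3_def)
  have Y: "coeff (coeff (coeff (Y3 * g) l) j) i =
      (if j = 0 then 0 else coeff (coeff (coeff g l) (j - 1)) i)" for g :: "'a poly3"
    by (cases j) (simp_all add: Y3_def)
  have Z: "coeff (coeff (coeff (Z3 * g) l) j) i =
      (if l = 0 then 0 else coeff (coeff (coeff g (l - 1)) j) i)" for g :: "'a poly3"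
    by (cases l) (simp_all add: Z3_def)
  have N: "coeff (coeff (coeff (of_nat n * g) l) j) i = of_nat n * coeff (coeff (coeff g l) j) i"
    for n and g :: "'a poly3"
    by (simp add: of_nat_poly)
  have "euler a b c f = of_nat a * (X3 * dx f) + of_nat b * (Y3 * dy f) + of_nat c * (Z3 * dz f)"
    by (simp add: euler_def mult.assoc)
  then show ?thesis
    by (auto simp only: coeff_add N X Y Z coeff_dx coeff_dy coeff_dz Suc_diff_1 split: if_splits)
       (simp_all add: algebra_simps)
qed

lemma euler_homogeneous:
  "homogeneous a b c n f \<Longrightarrow> euler a b c f = of_nat n * f"
  by (rule poly3_eqI)
    (auto simp: homogeneous_def coeff_euler of_nat_poly simp del: of_nat_add of_nat_mult)

lemma shuffle_perms_2_0: "shuffle_perms 2 0 = {id}"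
proof -
  have "\<sigma> = id" if "\<sigma> permutes {..<2}" "strict_mono_on {..<2} \<sigma>" for \<sigma> :: "nat \<Rightarrow> nat"
  proof
    fix i
    have "\<sigma> 0 < 2" "\<sigma> 1 < 2" using permutes_in_image[OF that(1)] by auto
    moreover have "\<sigma> 0 < \<sigma> 1" using that(2) by (auto simp: strict_mono_on_def)
    ultimately show "\<sigma> i = id i"
      using permutes_not_in[OF that(1), of i]
      by (cases "i = 0"; cases "i = 1") (auto simp: less_2_cases_iff)
  qed
  then show ?thesis
    by (auto simp: shuffle_perms_def permutes_id strict_mono_on_def)
qed

lemma shuffle_perms_1_1: "shuffle_perms 1 1 = {id, Transposition.transpose 0 1}"
proof -
  have "{..<1 + 1} = {0, 1 :: nat}" by auto
  moreover have "{\<sigma>. \<sigma> permutes {0, 1::nat}} = {id, Transposition.transpose 0 1}"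
    by (subst permutes_doubleton_iff[abs_def]) auto
  ultimately show ?thesis
    by (auto simp: shuffle_perms_def strict_mono_on_def)
qed

lemma shuffle_perms_1_2:
  "shuffle_perms 1 2 =
     {id, Transposition.transpose 0 1, Transposition.transpose 0 2 \<circ> Transposition.transpose 1 2}"
proof -
  have set3: "{..<1 + 2} = {0, 1, 2 :: nat}" "{1..<1 + 2} = {1, 2 :: nat}" by auto
  have perms2: "{\<sigma>. \<sigma> permutes {1, 2::nat}} = {id, Transposition.transpose 1 2}"
    by (subst permutes_doubleton_iff[abs_def]) auto
  have "{\<sigma>. \<sigma> permutes {0, 1, 2::nat}} =
      (\<lambda>(b, q). Transposition.transpose 0 b \<circ> q) ` ({0, 1, 2} \<times> {id, Transposition.transpose 1 2})"
    by (subst permutes_insert) (simp only: perms2 Collect_case_prod_Sigma Collect_mem_eq)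
  then have *: "shuffle_perms 1 2 = {\<sigma> \<in> {id, Transposition.transpose 1 2,
        Transposition.transpose 0 1, Transposition.transpose 0 1 \<circ> Transposition.transpose 1 2,
        Transposition.transpose 0 2, Transposition.transpose 0 2 \<circ> Transposition.transpose 1 2}.
        strict_mono_on {..<1} \<sigma> \<and> strict_mono_on {1, 2} \<sigma>}"
    unfolding shuffle_perms_def set3 by (auto simp: set_eq_iff)
  have sm: "strict_mono_on {..<1} \<sigma>" "strict_mono_on {1, 2} \<sigma> \<longleftrightarrow> \<sigma> 1 < \<sigma> 2"
    for \<sigma> :: "nat \<Rightarrow> nat"
    by (auto simp: strict_mono_on_def)
  show ?thesis
    unfolding * sm(2) using sm(1) by (auto simp: Transposition.transpose_def)
qed

lemma wedge_1_2:
  "wedge 1 2 P Q [f, g, h] = P [f] * Q [g, h] - P [g] * Q [f, h] + P [h] * Q [f, g]"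
proof -
  let ?t = "Transposition.transpose 0 (1::nat)"
  let ?c = "Transposition.transpose 0 2 \<circ> Transposition.transpose 1 (2::nat)"
  have neq: "id \<noteq> ?t" "id \<noteq> ?c" "?t \<noteq> ?c"
    by (auto simp: fun_eq_iff Transposition.transpose_def intro: exI[of _ 0])
  have sgn: "sign ?t = -1" "sign ?c = 1"
    by (simp_all add: sign_swap_id sign_compose permutation_swap_id)
  have vals: "[0..<1] = [0]" "[1..<1 + 2] = [1, 2]" "?c 0 = 2" "?c 1 = 0" "?c 2 = 1"
    by (simp_all add: upt_rec Transposition.transpose_def)
  show ?thesis
    unfolding wedge_def shuffle_perms_1_2 using neq
    by (simp add: sgn [simplified numeral_2_eq_2, simplified] vals [simplified] sign_id numeral_2_eq_2 Transposition.transpose_def)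
qed

lemma schouten_1_2:
  "schouten 1 2 (vector_field \<delta>) (bivector \<pi>) [f, g] = \<delta> (\<pi> f g) - (\<pi> (\<delta> f) g - \<pi> (\<delta> g) f)"
proof -
  let ?t = "Transposition.transpose 0 (1::nat)"
  have neq: "id \<noteq> ?t"
    by (auto simp: fun_eq_iff Transposition.transpose_def intro: exI[of _ 0])
  have upts: "[0..<2] = [0, 1]" "[0..<1] = [0]" "[1..<2] = [1]"
    "(2::nat) - 1 = 1" "(1::nat) - 1 = 0" "1 + 1 = (2::nat)"
    by (simp_all add: upt_rec)
  show ?thesis
    unfolding schouten_def upts shuffle_perms_2_0 shuffle_perms_1_1 using neq
    by (simp add: sign_swap_id sign_id vector_field_def bivector_def upts)
qed

end

theory Submission
  imports Defs "Berlekamp_Zassenhaus.Unique_Factorization_Poly"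
begin

text \<open>
  For a derivation \<open>\<delta>\<close> of degree 0 the semi-Poisson condition reduces to
  \<open>\<delta> \<Omega> = div \<delta> * \<Omega>\<close>, with \<open>div \<delta>\<close> constant. Subtracting a multiple of the Euler derivation,
  the question is whether there is a nonzero divergence-free \<open>\<delta>\<close> of degree 0 with \<open>\<delta> \<Omega> = 0\<close>.

  If \<open>\<Omega> = F * G\<close> with homogeneous non-constant factors, the Jacobian field \<open>\<nabla>F \<times> \<nabla>G\<close> is one. When it
  vanishes, one factor can be replaced by a monomial of the same degree, unless \<open>\<Omega>\<close> is itself a
  monomial, and then a diagonal field works.

  If \<open>\<Omega>\<close> is irreducible, let \<open>e = (a x, b y, c z)\<close> be the Euler field and put \<open>w = e \<times> \<delta>\<close>. Then
  \<open>curl w = - (a + b + c) \<delta>\<close> and \<open>\<nabla>\<Omega> \<times> w = \<Omega> curl w\<close>, that is, the rational 1-form \<open>w / \<Omega>\<close> is closed.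
  Its residue along the irreducible surface \<open>\<Omega> = 0\<close> is a constant \<open>r\<close>, so that
  \<open>w = r \<nabla>\<Omega> + \<Omega> u\<close> with \<open>curl u = 0\<close>. From \<open>e \<bullet> w = 0\<close> the function \<open>e \<bullet> u\<close> is constant; as \<open>u\<close> is
  closed, its partial derivatives are sums of an Euler derivative and a positive multiple of the
  components of \<open>u\<close>, which forces \<open>u = 0\<close>, hence \<open>curl w = 0\<close> and \<open>\<delta> = 0\<close>.
\<close>

section \<open>Derivations of the polynomial ring\<close>

definition const3 :: "'k::comm_ring_1 \<Rightarrow> 'k poly3" where
  "const3 r = [:[:[:r:]:]:]"

lemma scale3_eq: "scale3 r f = const3 r * f"
  by (simp add: scale3_def const3_def)

lemma const3_simps:
  "const3 (r + s) = const3 r + const3 s" "const3 (r * s) = const3 r * const3 s"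
  "const3 0 = 0" "const3 1 = 1" "const3 (- r) = - const3 r" "const3 (of_nat n) = of_nat n"
  unfolding const3_def by (simp_all add: of_nat_poly)

lemma const3_eq_0_iff [simp]: "const3 r = 0 \<longleftrightarrow> r = 0"
  by (simp add: const3_def)

lemma coeff_const3:
  "coeff (coeff (coeff (const3 r) l) j) i = (if l = 0 \<and> j = 0 \<and> i = 0 then r else 0)"
  by (cases l; cases j; cases i) (simp_all add: const3_def)

lemma coeff_const3_mult:
  "coeff (coeff (coeff (const3 r * f) l) j) i = r * coeff (coeff (coeff f l) j) i"
  by (simp add: const3_def)

lemma d_const3: "dx (const3 r) = 0" "dy (const3 r) = 0" "dz (const3 r) = 0"
  by (rule poly3_eqI; simp add: coeff_dx coeff_dy coeff_dz coeff_const3)+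

lemma d_of_nat: "dx (of_nat n) = 0" "dy (of_nat n) = 0" "dz (of_nat n) = 0"
  by (simp_all add: d_const3 flip: const3_simps)

lemma d_diff:
  "dx (f - g) = dx f - dx g" "dy (f - g) = dy f - dy g" "dz (f - g) = dz f - dz g"
  by (rule poly3_eqI; simp add: coeff_dx coeff_dy coeff_dz algebra_simps)+

lemma d_uminus: "dx (- f) = - dx f" "dy (- f) = - dy f" "dz (- f) = - dz f"
  by (rule poly3_eqI; simp add: coeff_dx coeff_dy coeff_dz)+

lemma d_0: "dx 0 = 0" "dy 0 = 0" "dz 0 = 0"
  by (rule poly3_eqI; simp add: coeff_dx coeff_dy coeff_dz)+

lemma d_commute: "dy (dx f) = dx (dy f)" "dz (dx f) = dx (dz f)" "dz (dy f) = dy (dz f)"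
  by (rule poly3_eqI; simp add: coeff_dx coeff_dy coeff_dz mult.left_commute del: of_nat_Suc)+

text \<open>Constants and the three variables generate the ring, so identities between derivations
  or between substitutions need checking only there.\<close>

lemma poly3_induct [case_names const X Y Z add mult]:
  fixes f :: "'k::comm_ring_1 poly3"
  assumes const: "\<And>r. P (const3 r)" and X: "P X3" and Y: "P Y3" and Z: "P Z3"
    and add: "\<And>f g. P f \<Longrightarrow> P g \<Longrightarrow> P (f + g)"
    and mult: "\<And>f g. P f \<Longrightarrow> P g \<Longrightarrow> P (f * g)"
  shows "P f"
proof -
  have 0: "P 0"
    using const[of 0] by (simp add: const3_def)
  have 1: "P [:[:s:]:]" for s :: "'k poly"
  proof (induction s)
    case (pCons r s)
    have "[:[:pCons r s:]:] = const3 r + X3 * [:[:s:]:]"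
      by (simp add: const3_def X3_def)
    then show ?case using pCons by (simp only: add mult const X)
  qed (simp add: 0)
  have 2: "P [:q:]" for q :: "'k poly poly"
  proof (induction q)
    case (pCons b q)
    have "[:pCons b q:] = [:[:b:]:] + Y3 * [:q:]"
      by (simp add: Y3_def)
    then show ?case using pCons by (simp only: add mult 1 Y)
  qed (simp add: 0)
  show ?thesis
  proof (induction f)
    case (pCons b q)
    have "pCons b q = [:b:] + Z3 * q"
      by (simp add: Z3_def)
    then show ?case using pCons by (simp only: add mult 2 Z)
  qed (simp add: 0)
qed

definition vfield ::
    "'k::field poly3 \<Rightarrow> 'k poly3 \<Rightarrow> 'k poly3 \<Rightarrow> 'k poly3 \<Rightarrow> 'k poly3" where
  "vfield u v w f = u * dx f + v * dy f + w * dz f"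

definition divergence :: "('k::field poly3 \<Rightarrow> 'k poly3) \<Rightarrow> 'k poly3" where
  "divergence \<delta> = dx (\<delta> X3) + dy (\<delta> Y3) + dz (\<delta> Z3)"

lemma vfield_generators:
  "vfield u v w X3 = u" "vfield u v w Y3 = v" "vfield u v w Z3 = w"
  by (simp_all add: vfield_def dx_simps dy_simps dz_simps)

lemma derivationI:
  fixes \<delta> :: "'k::field poly3 \<Rightarrow> 'k poly3"
  assumes "\<And>f g. \<delta> (f + g) = \<delta> f + \<delta> g" "\<And>r f. \<delta> (const3 r * f) = const3 r * \<delta> f"
    and "\<And>f g. \<delta> (f * g) = \<delta> f * g + f * \<delta> g"
  shows "derivation \<delta>"
proof -
  have "module_hom scale3 scale3 \<delta>"
    unfolding module_hom_def module_hom_axioms_def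
    using vector_space_scale3[where ?'k = 'k] assms(1,2)
    by (auto simp: module_iff_vector_space scale3_eq)
  then show ?thesis
    by (simp add: derivation_def module_hom_iff_linear assms(3))
qed

lemma derivation_vfield: "derivation (vfield u v w)"
  by (rule derivationI) (simp_all add: vfield_def d_add d_mult d_const3 algebra_simps)

lemma derivationD:
  fixes \<delta> :: "'k::field poly3 \<Rightarrow> 'k poly3"
  assumes "derivation \<delta>"
  shows "\<delta> (f + g) = \<delta> f + \<delta> g" "\<delta> (const3 r * f) = const3 r * \<delta> f"
    "\<delta> (f * g) = \<delta> f * g + f * \<delta> g" "\<delta> (const3 r) = 0"
proof -
  have hom: "module_hom scale3 scale3 \<delta>" and m: "\<delta> (f * g) = \<delta> f * g + f * \<delta> g" for f g
    using assms by (auto simp: derivation_def module_hom_iff_linear)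
  show "\<delta> (f + g) = \<delta> f + \<delta> g" "\<delta> (f * g) = \<delta> f * g + f * \<delta> g"
    by (simp_all add: module_hom.add[OF hom] m)
  show scale: "\<delta> (const3 r * f) = const3 r * \<delta> f" for r f
    using module_hom.scale[OF hom, of r f] by (simp add: scale3_eq)
  have "\<delta> 1 = 0"
    using m[of 1 1] by (metis add_cancel_left_left mult_1 mult.right_neutral)
  then show "\<delta> (const3 r) = 0"
    using scale[of r 1] by simp
qed

lemma derivation_eq_vfield:
  assumes "derivation \<delta>"
  shows "\<delta> = vfield (\<delta> X3) (\<delta> Y3) (\<delta> Z3)"
proof
  fix f
  show "\<delta> f = vfield (\<delta> X3) (\<delta> Y3) (\<delta> Z3) f"
    by (induction f rule: poly3_induct)
      (simp_all add: derivationD[OF assms] derivationD[OF derivation_vfield] vfield_generators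
        del: mult_pCons_left mult_pCons_right)
qed

lemma bracket_eq:
  "bracket \<Omega> f g = dx f * (dy g * dz \<Omega> - dz g * dy \<Omega>) - dy f * (dx g * dz \<Omega> - dz g * dx \<Omega>)
     + dz f * (dx g * dy \<Omega> - dy g * dx \<Omega>)"
  by (simp add: bracket_def det_3 algebra_simps)

text \<open>The Jacobian bivector is the contraction of the differential of \<open>\<Omega>\<close>
  with the standard trivector, and the Lie derivative along \<open>\<delta>\<close> multiplies that
  trivector by minus the divergence.\<close>

lemma schouten_vfield:
  fixes \<Omega> :: "'k::field poly3"
  assumes "\<delta> = vfield u v w"
  shows "schouten 1 2 (vector_field \<delta>) (bivector (bracket \<Omega>)) [f, g] =
    bracket (\<delta> \<Omega>) f g - (dx u + dy v + dz w) * bracket \<Omega> f g"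
  unfolding schouten_1_2 bracket_eq assms vfield_def
  by (simp add: d_add d_diff d_mult d_commute algebra_simps)

section \<open>Degree 0 semi-Poisson derivations\<close>

lemma derivation_diff:
  assumes "derivation \<delta>" shows "\<delta> (f - g) = \<delta> f - \<delta> g"
  using derivationD(1)[OF assms, of "f - g" g] by simp

lemma derivation_of_nat_mult:
  assumes "derivation \<delta>" shows "\<delta> (of_nat n * f) = of_nat n * \<delta> f"
  using derivationD(2)[OF assms, of "of_nat n"] by (simp add: const3_simps)

lemma derivation_of_nat:
  assumes "derivation \<delta>" shows "\<delta> (of_nat n) = 0" "\<delta> 0 = 0"
  using derivationD(4)[OF assms, of "of_nat n"] derivationD(4)[OF assms, of 0]
  by (simp_all add: const3_simps)

lemma euler_eq_vfield:
  "euler a b c = vfield (of_nat a * X3) (of_nat b * Y3) (of_nat c * Z3)"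
  by (simp add: fun_eq_iff euler_def vfield_def)

lemmas euler_simps = derivationD[OF derivation_euler]
  derivation_diff[OF derivation_euler] derivation_of_nat_mult[OF derivation_euler]
  derivation_of_nat[OF derivation_euler]

lemma euler_generators:
  "euler a b c X3 = of_nat a * X3" "euler a b c Y3 = of_nat b * Y3"
  "euler a b c Z3 = of_nat c * Z3"
  by (simp_all add: euler_eq_vfield vfield_generators)

text \<open>In characteristic zero the Euler eigenvalue of a monomial determines its degree, so
  homogeneity becomes an equation open to algebra.\<close>

lemma homogeneous_iff_euler:
  fixes f :: "'k::field_char_0 poly3"
  shows "homogeneous a b c n f \<longleftrightarrow> euler a b c f = of_nat n * f"
proof
  assume *: "euler a b c f = of_nat n * f"
  show "homogeneous a b c n f"
    unfolding homogeneous_def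
  proof (intro allI impI)
    fix i j l
    assume nz: "coeff (coeff (coeff f l) j) i \<noteq> 0"
    have "of_nat (a * i + b * j + c * l) * coeff (coeff (coeff f l) j) i =
        of_nat n * coeff (coeff (coeff f l) j) i"
      using arg_cong[OF *, of "\<lambda>g. coeff (coeff (coeff g l) j) i"]
      by (simp only: coeff_euler const3_simps(6)[symmetric] coeff_const3_mult)
    then show "a * i + b * j + c * l = n"
      using nz by (simp only: mult_cancel_right of_nat_eq_iff) simp
  qed
qed (rule euler_homogeneous)

lemma euler_dx: "euler a b c (dx f) + of_nat a * dx f = dx (euler a b c f)"
  and euler_dy: "euler a b c (dy f) + of_nat b * dy f = dy (euler a b c f)"
  and euler_dz: "euler a b c (dz f) + of_nat c * dz f = dz (euler a b c f)"
  by (simp_all add: euler_def d_add d_mult d_of_nat dx_simps dy_simps dz_simps d_commute algebra_simps)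

lemma homogeneous_mult:
  fixes f g :: "'k::field_char_0 poly3"
  assumes "homogeneous a b c m f" "homogeneous a b c n g"
  shows "homogeneous a b c (m + n) (f * g)"
  using assms by (simp add: homogeneous_iff_euler euler_simps algebra_simps)

lemma homogeneous_0_const:
  assumes "homogeneous a b c 0 f" "a > 0" "b > 0" "c > 0"
  shows "\<exists>r. f = const3 r"
proof
  show "f = const3 (coeff (coeff (coeff f 0) 0) 0)"
    by (rule poly3_eqI) (use assms in \<open>auto simp: coeff_const3 homogeneous_def\<close>)
qed

text \<open>Degree 0 amounts to commuting with the Euler derivation, and this can be tested on
  generators.\<close>

lemma degree0_map_iff:
  fixes \<delta> :: "'k::field_char_0 poly3 \<Rightarrow> 'k poly3"
  assumes "derivation \<delta>"
  shows "degree0_map a b c \<delta> \<longleftrightarrow> euler a b c (\<delta> X3) = of_nat a * \<delta> X3 \<and>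
    euler a b c (\<delta> Y3) = of_nat b * \<delta> Y3 \<and> euler a b c (\<delta> Z3) = of_nat c * \<delta> Z3"
proof
  assume "degree0_map a b c \<delta>"
  then show "euler a b c (\<delta> X3) = of_nat a * \<delta> X3 \<and>
    euler a b c (\<delta> Y3) = of_nat b * \<delta> Y3 \<and> euler a b c (\<delta> Z3) = of_nat c * \<delta> Z3"
    by (auto simp: degree0_map_def homogeneous_iff_euler euler_generators)
next
  assume *: "euler a b c (\<delta> X3) = of_nat a * \<delta> X3 \<and>
    euler a b c (\<delta> Y3) = of_nat b * \<delta> Y3 \<and> euler a b c (\<delta> Z3) = of_nat c * \<delta> Z3"
  have comm: "euler a b c (\<delta> f) = \<delta> (euler a b c f)" for f
    by (induction f rule: poly3_induct)
      (simp_all add: * euler_generators derivationD[OF assms] euler_simps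
        derivation_of_nat_mult[OF assms] derivation_of_nat[OF assms] algebra_simps)
  show "degree0_map a b c \<delta>"
    by (simp add: degree0_map_def homogeneous_iff_euler comm derivation_of_nat_mult[OF assms])
qed

lemma degree0_map_euler_commute:
  fixes \<delta> :: "'k::field_char_0 poly3 \<Rightarrow> 'k poly3"
  assumes "degree0_map a b c \<delta>" "homogeneous a b c n f"
  shows "euler a b c (\<delta> f) = of_nat n * \<delta> f"
  using assms by (auto simp: degree0_map_def homogeneous_iff_euler)

lemma euler_divergence:
  fixes \<delta> :: "'k::field_char_0 poly3 \<Rightarrow> 'k poly3"
  assumes "derivation \<delta>" "degree0_map a b c \<delta>"
  shows "euler a b c (divergence \<delta>) = 0"
proof -
  have *: "euler a b c (\<delta> X3) = of_nat a * \<delta> X3" "euler a b c (\<delta> Y3) = of_nat b * \<delta> Y3"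
    "euler a b c (\<delta> Z3) = of_nat c * \<delta> Z3"
    using assms(2) degree0_map_iff[OF assms(1)] by auto
  show ?thesis
    using euler_dx[of a b c "\<delta> X3"] euler_dy[of a b c "\<delta> Y3"] euler_dz[of a b c "\<delta> Z3"]
    by (simp add: * divergence_def euler_simps d_mult d_of_nat)
qed

lemma divergence_const:
  fixes \<delta> :: "'k::field_char_0 poly3 \<Rightarrow> 'k poly3"
  assumes "derivation \<delta>" "degree0_map a b c \<delta>" "a > 0" "b > 0" "c > 0"
  obtains r where "divergence \<delta> = const3 r"
  using homogeneous_0_const[OF _ assms(3-5), of "divergence \<delta>"] euler_divergence[OF assms(1,2)]
  by (auto simp: homogeneous_iff_euler)

text \<open>On \<open>X3, Y3, Z3\<close> the wedge of the Euler field with the Jacobian bivector of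
  a potential is the Euler derivative of that potential. The condition thus equates the Euler
  derivative of \<open>\<delta> \<Omega>\<close> with \<open>divergence \<delta>\<close> times that
  of \<open>\<Omega>\<close>; both have degree \<open>n\<close>, and the factor \<open>n\<close>
  cancels.\<close>

lemma semi_poisson_imp:
  fixes \<Omega> :: "'k::field_char_0 poly3"
  assumes "semi_poisson a b c \<Omega> \<delta>" "degree0_map a b c \<delta>"
    and \<Omega>: "homogeneous a b c n \<Omega>" and "n > 0"
  shows "\<delta> \<Omega> = divergence \<delta> * \<Omega>"
proof -
  have \<delta>: "derivation \<delta>" and w: "wedge 1 2 (vector_field (euler a b c))
      (schouten 1 2 (vector_field \<delta>) (bivector (bracket \<Omega>))) [X3, Y3, Z3] = 0"
    using assms(1) by (auto simp: semi_poisson_def)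
  note sch = schouten_vfield[OF derivation_eq_vfield[OF \<delta>], folded divergence_def]
  let ?F = "\<delta> \<Omega> - divergence \<delta> * \<Omega>"
  have "of_nat n * ?F = euler a b c (\<delta> \<Omega>) - divergence \<delta> * euler a b c \<Omega>"
    using degree0_map_euler_commute[OF assms(2) \<Omega>] \<Omega>
    by (simp add: homogeneous_iff_euler algebra_simps)
  also have "\<dots> = 0"
    using w unfolding wedge_1_2 sch
    by (simp add: vector_field_def euler_def bracket_eq dx_simps dy_simps dz_simps algebra_simps)
  finally show ?thesis
    using \<open>n > 0\<close> by simp
qed

text \<open>For constant \<open>r\<close> the two terms in \<open>schouten_vfield\<close> cancel, so
  \<open>\<delta>\<close> is even a Poisson derivation.\<close>

lemma semi_poissonI:
  assumes \<delta>: "derivation \<delta>" and "\<delta> \<Omega> = const3 r * \<Omega>" "divergence \<delta> = const3 r"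
  shows "semi_poisson a b c \<Omega> \<delta>"
proof -
  have "schouten 1 2 (vector_field \<delta>) (bivector (bracket \<Omega>)) [f, g] = 0" for f g
    unfolding schouten_vfield[OF derivation_eq_vfield[OF \<delta>], folded divergence_def] assms(2,3)
    by (simp add: bracket_eq d_mult d_const3 algebra_simps)
  then show ?thesis
    using \<delta> by (auto simp: semi_poisson_def numeral_3_eq_3 length_Suc_conv wedge_1_2 simp del: One_nat_def)
qed

lemma divergence_euler: "divergence (euler a b c) = const3 (of_nat (a + b + c))"
  by (simp add: divergence_def euler_generators d_mult d_of_nat dx_simps dy_simps dz_simps const3_simps)

lemma euler_in_Gspd:
  fixes \<Omega> :: "'k::field_char_0 poly3"
  assumes "homogeneous a b c (a + b + c) \<Omega>"
  shows "euler a b c \<in> Gspd a b c \<Omega>"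
proof -
  have "euler a b c \<Omega> = const3 (of_nat (a + b + c)) * \<Omega>"
    using assms by (simp add: homogeneous_iff_euler const3_simps)
  then show ?thesis
    using derivation_euler divergence_euler
    by (auto simp: Gspd_def degree0_map_iff[OF derivation_euler] euler_generators euler_simps intro!: semi_poissonI)
qed

section \<open>Homogeneous factors\<close>

lemma comm_ring_hom_eval:
  assumes "comm_ring_hom h"
  shows "comm_ring_hom (\<lambda>p. poly (map_poly h p) x)"
proof -
  interpret h: comm_ring_hom h by (rule assms)
  interpret m: map_poly_comm_ring_hom h ..
  show ?thesis
    by unfold_locales (simp_all add: m.hom_add m.hom_mult)
qed

text \<open>The homomorphism given by the universal property of the polynomial ring. It serves for
  gradings, point evaluation and exchange of coordinates.\<close>

definition subst3 ::
    "('k::comm_ring_1 \<Rightarrow> 'r::comm_ring_1) \<Rightarrow> 'r \<Rightarrow> 'r \<Rightarrow> 'r \<Rightarrow> 'k poly3 \<Rightarrow> 'r" where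
  "subst3 h x y z f =
     poly (map_poly (\<lambda>p. poly (map_poly (\<lambda>q. poly (map_poly h q) x) p) y) f) z"

lemma comm_ring_hom_subst3: "comm_ring_hom h \<Longrightarrow> comm_ring_hom (subst3 h x y z)"
  unfolding subst3_def[abs_def] by (intro comm_ring_hom_eval)

lemma subst3_simps:
  assumes "comm_ring_hom h"
  shows "subst3 h x y z (const3 r) = h r" "subst3 h x y z X3 = x" "subst3 h x y z Y3 = y"
    "subst3 h x y z Z3 = z" "subst3 h x y z (f + g) = subst3 h x y z f + subst3 h x y z g"
    "subst3 h x y z (f * g) = subst3 h x y z f * subst3 h x y z g"
    "subst3 h x y z (f - g) = subst3 h x y z f - subst3 h x y z g"
    "subst3 h x y z 0 = 0" "subst3 h x y z (of_nat n) = of_nat n"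
    "subst3 h x y z (f ^ n) = subst3 h x y z f ^ n"
proof -
  interpret h: comm_ring_hom h by (rule assms)
  interpret s: comm_ring_hom "subst3 h x y z" by (rule comm_ring_hom_subst3[OF assms])
  show "subst3 h x y z (const3 r) = h r" "subst3 h x y z X3 = x" "subst3 h x y z Y3 = y"
    "subst3 h x y z Z3 = z"
    by (cases "r = 0"; simp add: subst3_def const3_def X3_def Y3_def Z3_def map_poly_pCons)+
  show "subst3 h x y z (f + g) = subst3 h x y z f + subst3 h x y z g"
    "subst3 h x y z (f * g) = subst3 h x y z f * subst3 h x y z g"
    "subst3 h x y z (f - g) = subst3 h x y z f - subst3 h x y z g"
    "subst3 h x y z 0 = 0" "subst3 h x y z (f ^ n) = subst3 h x y z f ^ n"
    by (simp_all add: s.hom_add s.hom_mult s.hom_minus s.hom_power)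
  show "subst3 h x y z (of_nat n) = of_nat n"
    by (induction n) (simp_all add: s.hom_add)
qed

text \<open>With T the new indeterminate, the coefficient of \<open>T^m\<close> is the homogeneous
  component of degree \<open>m\<close>.\<close>

definition grading :: "nat \<Rightarrow> nat \<Rightarrow> nat \<Rightarrow> 'k::field poly3 \<Rightarrow> 'k poly3 poly" where
  "grading a b c = subst3 (\<lambda>r. [:const3 r:]) (monom X3 a) (monom Y3 b) (monom Z3 c)"

lemma comm_ring_hom_const_poly_const3: "comm_ring_hom (\<lambda>r::'k::field. [:const3 r:])"
  by unfold_locales (simp_all add: const3_simps)

lemmas grading_simps = subst3_simps[OF comm_ring_hom_const_poly_const3, of "monom X3 a" "monom Y3 b" "monom Z3 c" for a b c,
  folded grading_def]

lemma homogeneous_sum: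
  fixes f :: "'i \<Rightarrow> 'k::field_char_0 poly3"
  assumes "\<And>i. i \<in> I \<Longrightarrow> homogeneous a b c n (f i)"
  shows "homogeneous a b c n (sum f I)"
  using assms
  by (induction I rule: infinite_finite_induct) (simp_all add: homogeneous_iff_euler euler_simps algebra_simps)

lemma homogeneous_coeff_grading:
  fixes f :: "'k::field_char_0 poly3"
  shows "homogeneous a b c m (coeff (grading a b c f) m)"
proof (induction f arbitrary: m rule: poly3_induct)
  case (const r)
  then show ?case
    by (cases m) (simp_all add: grading_simps homogeneous_iff_euler euler_simps)
next
  case (mult f g)
  then show ?case
    by (auto simp: grading_simps coeff_mult intro!: homogeneous_sum)
      (metis homogeneous_mult le_add_diff_inverse)
qed (simp_all add: grading_simps homogeneous_iff_euler euler_simps euler_generators distrib_left)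

lemma poly_grading_1: "poly (grading a b c f) 1 = f"
  by (induction f rule: poly3_induct) (simp_all add: grading_simps poly_monom)

text \<open>The Euler derivation corresponds to T d/dT; the factor \<open>[:0, 1:]\<close> is
  T.\<close>

lemma pderiv_grading:
  fixes f :: "'k::field_char_0 poly3"
  shows "[:0, 1:] * pderiv (grading a b c f) = grading a b c (euler a b c f)"
proof -
  have m: "pCons 0 (pderiv (monom u n)) = of_nat n * monom u n" for u :: "'k poly3" and n
    by (rule poly_eqI)
      (simp add: coeff_pCons coeff_pderiv of_nat_poly split: nat.splits del: of_nat_Suc)
  show ?thesis
  proof (induction f rule: poly3_induct)
    case (mult f g)
    have "[:0, 1:] * pderiv (grading a b c (f * g)) =
        ([:0, 1:] * pderiv (grading a b c f)) * grading a b c g +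
        grading a b c f * ([:0, 1:] * pderiv (grading a b c g))"
      by (simp add: grading_simps pderiv_mult algebra_simps del: mult_pCons_left mult_pCons_right)
    then show ?case
      by (simp only: mult euler_simps grading_simps)
  next
    case (add f g)
    then show ?case
      by (simp only: grading_simps pderiv_add euler_simps distrib_left)
  qed (simp_all add: grading_simps m euler_simps euler_generators pderiv_pCons)
qed

lemma grading_homogeneous:
  fixes f :: "'k::field_char_0 poly3"
  assumes "homogeneous a b c n f"
  shows "grading a b c f = monom f n"
proof -
  have *: "coeff (pCons 0 (pderiv (grading a b c f))) m = of_nat n * coeff (grading a b c f) m" for m
  proof -
    have "coeff (of_nat n * g) m = of_nat n * coeff g m" for g :: "'k poly3 poly"
      by (simp add: of_nat_poly)
    then show ?thesis
      using pderiv_grading[of a b c f] assms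
      by (simp add: homogeneous_iff_euler grading_simps)
  qed
  have "of_nat m * coeff (grading a b c f) m = of_nat n * coeff (grading a b c f) m" for m
    using * [of m] by (cases m) (simp_all add: coeff_pderiv)
  then have 0: "coeff (grading a b c f) m = 0" if "m \<noteq> n" for m
    using that by (metis mult_cancel_right of_nat_eq_iff)
  have mon: "grading a b c f = monom (coeff (grading a b c f) n) n"
    by (rule poly_eqI) (simp add: 0)
  have "f = coeff (grading a b c f) n"
    using arg_cong[OF mon, of "\<lambda>p. poly p 1"] by (simp add: poly_grading_1 poly_monom)
  with mon show ?thesis by metis
qed

text \<open>Under \<open>grading\<close>, \<open>\<Omega>\<close> becomes a single term in T.
  Comparing leading terms, the components of top degree of \<open>F\<close> and \<open>G\<close>
  multiply to \<open>\<Omega>\<close>, and their degrees add up to \<open>n\<close>.\<close>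

lemma homogeneous_factors:
  fixes \<Omega> F G :: "'k::field_char_0 poly3"
  assumes "a > 0" "b > 0" "c > 0" and \<Omega>: "homogeneous a b c n \<Omega>" "\<Omega> \<noteq> 0"
    and FG: "\<Omega> = F * G" "\<not> F dvd 1" "\<not> G dvd 1"
  obtains p q F' G' where "p > 0" "q > 0" "p + q = n" "homogeneous a b c p F'"
    "homogeneous a b c q G'" "\<Omega> = F' * G'"
proof -
  have eq: "monom \<Omega> n = grading a b c F * grading a b c G"
    using grading_homogeneous[OF \<Omega>(1)] by (simp add: FG(1) flip: grading_simps)
  have nz: "grading a b c F \<noteq> 0" "grading a b c G \<noteq> 0"
    using eq \<Omega>(2) by auto
  \<comment> \<open>Positive weights leave only constants in degree 0, and a nonzero constant is a
    unit.\<close>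
  have pos: "degree (grading a b c H) > 0" if "\<not> H dvd 1" "grading a b c H \<noteq> 0" for H :: "'k poly3"
  proof (rule ccontr)
    assume "\<not> degree (grading a b c H) > 0"
    then obtain h where h: "grading a b c H = [:h:]"
      by (auto elim: degree_eq_zeroE)
    then have "homogeneous a b c 0 h"
      using homogeneous_coeff_grading[of a b c 0 H] by simp
    then obtain r where r: "h = const3 r"
      using homogeneous_0_const assms(1-3) by blast
    then have H: "H = const3 r"
      using h poly_grading_1[of a b c H] by simp
    have "r \<noteq> 0"
      using that(2) h r by auto
    then have "H * const3 (inverse r) = 1"
      by (simp add: H flip: const3_simps)
    then show False
      using that(1) by (metis dvd_triv_left)
  qed
  show ?thesis
  proof
    show "degree (grading a b c F) > 0" "degree (grading a b c G) > 0"
      using pos FG nz by auto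
    show "degree (grading a b c F) + degree (grading a b c G) = n"
      using arg_cong[OF eq, of degree] \<Omega>(2) nz by (simp add: degree_mult_eq degree_monom_eq)
    show "\<Omega> = lead_coeff (grading a b c F) * lead_coeff (grading a b c G)"
      using arg_cong[OF eq, of lead_coeff] \<Omega>(2) by (simp add: lead_coeff_mult degree_monom_eq)
  qed (rule homogeneous_coeff_grading)+
qed

section \<open>Reducible potentials\<close>

definition mono3 :: "nat \<Rightarrow> nat \<Rightarrow> nat \<Rightarrow> 'k::comm_ring_1 poly3" where
  "mono3 i j l = monom (monom (monom 1 i) j) l"

lemma coeff_mono3:
  "coeff (coeff (coeff (mono3 i j l) t) s) r = (if r = i \<and> s = j \<and> t = l then 1 else 0)"
  by (auto simp: mono3_def)

lemma mono3_nonzero [simp]: "mono3 i j l \<noteq> 0"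
  by (simp add: mono3_def)

lemma homogeneous_mono3: "homogeneous a b c (a * i + b * j + c * l) (mono3 i j l)"
  by (simp add: homogeneous_def coeff_mono3)

lemma coeff_log_derivative:
  "coeff (coeff (coeff (X3 * dx f) l) j) i = of_nat i * coeff (coeff (coeff f l) j) i"
  "coeff (coeff (coeff (Y3 * dy f) l) j) i = of_nat j * coeff (coeff (coeff f l) j) i"
  "coeff (coeff (coeff (Z3 * dz f) l) j) i = of_nat l * coeff (coeff (coeff f l) j) i"
  \<comment> \<open>Each logarithmic derivative is the Euler derivation with one weight 1 and the
    other two 0.\<close>
  using coeff_euler[of 1 0 0 f l j i] coeff_euler[of 0 1 0 f l j i] coeff_euler[of 0 0 1 f l j i]
  by (simp_all add: euler_def)

lemma log_derivative_mono3:
  "X3 * dx (mono3 i j l) = of_nat i * mono3 i j l" "Y3 * dy (mono3 i j l) = of_nat j * mono3 i j l"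
  "Z3 * dz (mono3 i j l) = of_nat l * mono3 i j l"
  by (rule poly3_eqI; simp only: coeff_log_derivative coeff_const3_mult flip: const3_simps(6);
      simp add: coeff_mono3)+

text \<open>Parallel gradients make the logarithmic gradients parallel, and those of a monomial are
  given by its exponents. So every exponent vector of \<open>F\<close> is proportional to
  \<open>(i, j, l)\<close>; the degrees \<open>p\<close> and \<open>q\<close> fix the ratio, which
  is stated without division.\<close>

lemma parallel_gradient_mono3:
  fixes F :: "'k::field_char_0 poly3" and i j l :: nat
  defines "U \<equiv> mono3 i j l"
  assumes "homogeneous a b c p F" and q: "a * i + b * j + c * l = q"
    and par: "dx F * dy U = dy F * dx U" "dx F * dz U = dz F * dx U" "dy F * dz U = dz F * dy U"
    and nz: "coeff (coeff (coeff F t) s) r \<noteq> 0"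
  shows "r * q = i * p" "s * q = j * p" "t * q = l * p"
proof -
  have Unz: "U \<noteq> 0" by (simp add: U_def)
  have swap: "(x * f) * (y * v) = (y * g) * (x * u)" if "f * v = g * u" for x y f v g u :: "'k poly3"
  proof -
    have "(x * f) * (y * v) = x * y * (f * v)" by (simp only: ac_simps)
    also have "\<dots> = (y * g) * (x * u)" unfolding that by (simp only: ac_simps)
    finally show ?thesis .
  qed
  have log: "X3 * dx U = of_nat i * U" "Y3 * dy U = of_nat j * U" "Z3 * dz U = of_nat l * U"
    unfolding U_def by (rule log_derivative_mono3)+
  have "U * (of_nat j * (X3 * dx F)) = U * (of_nat i * (Y3 * dy F))"
    using swap[OF par(1), of X3 Y3] unfolding log by (simp only: ac_simps)
  moreover have "U * (of_nat l * (X3 * dx F)) = U * (of_nat i * (Z3 * dz F))"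
    using swap[OF par(2), of X3 Z3] unfolding log by (simp only: ac_simps)
  moreover have "U * (of_nat l * (Y3 * dy F)) = U * (of_nat j * (Z3 * dz F))"
    using swap[OF par(3), of Y3 Z3] unfolding log by (simp only: ac_simps)
  ultimately have e: "const3 (of_nat j) * (X3 * dx F) = const3 (of_nat i) * (Y3 * dy F)"
    "const3 (of_nat l) * (X3 * dx F) = const3 (of_nat i) * (Z3 * dz F)"
    "const3 (of_nat l) * (Y3 * dy F) = const3 (of_nat j) * (Z3 * dz F)"
    using Unz by (simp_all add: const3_simps)
  note e' = e[THEN arg_cong, of "\<lambda>g. coeff (coeff (coeff g t) s) r",
      unfolded coeff_const3_mult coeff_log_derivative]
  have cancel: "u * u' = v * v'"
    if "of_nat u * (of_nat u' * \<kappa>) = of_nat v * (of_nat v' * \<kappa>)" "\<kappa> \<noteq> 0"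
    for u u' v v' and \<kappa> :: 'k
  proof -
    have "of_nat (u * u') * \<kappa> = of_nat (v * v') * \<kappa>"
      using that(1) by (simp add: mult.assoc)
    then show ?thesis
      using that(2) by (simp only: mult_cancel_right of_nat_eq_iff) simp
  qed
  have par': "j * r = i * s" "l * r = i * t" "l * s = j * t"
    by (rule cancel[OF _ nz], rule e')+
  have p: "a * r + b * s + c * t = p"
    using assms(2) nz by (auto simp: homogeneous_def)
  have "r * q = a * (i * r) + b * (j * r) + c * (l * r)" "i * p = a * (i * r) + b * (i * s) + c * (i * t)"
    "s * q = a * (i * s) + b * (j * s) + c * (l * s)" "j * p = a * (j * r) + b * (j * s) + c * (j * t)"
    "t * q = a * (i * t) + b * (j * t) + c * (l * t)" "l * p = a * (l * r) + b * (l * s) + c * (l * t)"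
    unfolding p[symmetric] q[symmetric] by (simp_all add: algebra_simps)
  then show "r * q = i * p" "s * q = j * p" "t * q = l * p"
    by (simp_all add: par')
qed

lemma mono3_expansion:
  assumes "\<And>r s t. coeff (coeff (coeff F t) s) r \<noteq> 0 \<Longrightarrow> r = i \<and> s = j \<and> t = l"
  shows "F = const3 (coeff (coeff (coeff F l) j) i) * mono3 i j l"
  by (rule poly3_eqI) (use assms in \<open>force simp: coeff_const3_mult coeff_mono3\<close>)

lemma mono3_mult: "mono3 i j l * mono3 r s t = mono3 (i + r) (j + s) (l + t)"
  by (simp add: mono3_def mult_monom)

lemma nonzero_coeffE:
  fixes F :: "'k::field poly3"
  assumes "F \<noteq> 0"
  obtains r s t where "coeff (coeff (coeff F t) s) r \<noteq> 0"
proof -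
  have "\<exists>r s t. coeff (coeff (coeff F t) s) r \<noteq> 0"
  proof (rule ccontr)
    assume "\<not> ?thesis"
    then have "F = 0" by (intro poly3_eqI) simp
    with assms show False by simp
  qed
  then show ?thesis using that by blast
qed

text \<open>With parallel gradients every exponent vector of \<open>F\<close> would be
  \<open>p / q\<close> times \<open>(i, j, l)\<close>, leaving \<open>F\<close> a single
  term.\<close>

lemma monomial_or_independent:
  fixes F :: "'k::field_char_0 poly3"
  assumes "F \<noteq> 0" "homogeneous a b c p F" and q: "a * i + b * j + c * l = q" "q > 0"
    and "\<not> (\<exists>r s t \<kappa>. F = const3 \<kappa> * mono3 r s t)"
  shows "dx F * dy (mono3 i j l) \<noteq> dy F * dx (mono3 i j l) \<or>
    dx F * dz (mono3 i j l) \<noteq> dz F * dx (mono3 i j l) \<or>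
    dy F * dz (mono3 i j l) \<noteq> dz F * dy (mono3 i j l)"
proof (rule ccontr)
  assume "\<not> ?thesis"
  then have par: "r * q = i * p" "s * q = j * p" "t * q = l * p"
    if "coeff (coeff (coeff F t) s) r \<noteq> 0" for r s t
    using parallel_gradient_mono3[OF assms(2) q(1) _ _ _ that] by auto
  obtain r s t where nz: "coeff (coeff (coeff F t) s) r \<noteq> 0"
    using nonzero_coeffE[OF \<open>F \<noteq> 0\<close>] .
  have "F = const3 (coeff (coeff (coeff F t) s) r) * mono3 r s t"
  proof (rule mono3_expansion)
    fix r' s' t'
    assume "coeff (coeff (coeff F t') s') r' \<noteq> 0"
    from par[OF this] par[OF nz] show "r' = r \<and> s' = s \<and> t' = t"
      using \<open>q > 0\<close> by (metis mult_cancel2 not_gr0)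
  qed
  then show False
    using assms(5) by blast
qed

text \<open>This field is the cross product of the gradients of \<open>F\<close> and
  \<open>U\<close>.\<close>

lemma bracket_eq_vfield:
  "(\<lambda>f. bracket U f F) = vfield (dy F * dz U - dz F * dy U) (dz F * dx U - dx F * dz U)
     (dx F * dy U - dy F * dx U)"
  by (simp add: fun_eq_iff bracket_eq vfield_def algebra_simps)

lemma derivation_bracket: "derivation (\<lambda>f. bracket U f F)"
  unfolding bracket_eq_vfield by (rule derivation_vfield)

lemma bracket_self: "bracket U F F = 0" "bracket U U F = 0"
  by (simp_all add: bracket_eq algebra_simps)

lemma bracket_generator:
  "bracket U X3 F = dy F * dz U - dz F * dy U" "bracket U Y3 F = dz F * dx U - dx F * dz U"
  "bracket U Z3 F = dx F * dy U - dy F * dx U"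
  by (simp_all add: bracket_eq dx_simps dy_simps dz_simps algebra_simps)

lemma divergence_bracket: "divergence (\<lambda>f. bracket U f F) = 0"
  by (simp add: divergence_def bracket_generator d_diff d_mult d_commute algebra_simps)

text \<open>Each component has degree \<open>p + q\<close> minus the weights of two variables, which
  is the weight of the third.\<close>

lemma degree0_map_bracket:
  fixes F U :: "'k::field_char_0 poly3"
  assumes F: "homogeneous a b c p F" and U: "homogeneous a b c q U" and "p + q = a + b + c"
  shows "degree0_map a b c (\<lambda>f. bracket U f F)"
proof -
  have E: "euler a b c (dx f) = of_nat n * dx f - of_nat a * dx f"
    "euler a b c (dy f) = of_nat n * dy f - of_nat b * dy f"
    "euler a b c (dz f) = of_nat n * dz f - of_nat c * dz f"
    if "homogeneous a b c n f" for n and f :: "'k poly3"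
    using that euler_dx[of a b c f] euler_dy[of a b c f] euler_dz[of a b c f]
    by (simp_all add: homogeneous_iff_euler d_mult d_of_nat algebra_simps)
  have p: "(of_nat p :: 'k poly3) = of_nat a + of_nat b + of_nat c - of_nat q"
    using assms(3) by (metis add_diff_cancel_right' of_nat_add)
  show ?thesis
    by (simp add: degree0_map_iff[OF derivation_bracket] bracket_generator euler_simps
        E[OF F] E[OF U] p algebra_simps)
qed

lemma bracket_nonzero:
  assumes "dx F * dy U \<noteq> dy F * dx U \<or> dx F * dz U \<noteq> dz F * dx U \<or> dy F * dz U \<noteq> dz F * dy U"
  shows "(\<lambda>f. bracket U f F) \<noteq> (\<lambda>f. 0)"
proof
  assume 0: "(\<lambda>f. bracket U f F) = (\<lambda>f. 0)"
  have "dy F * dz U - dz F * dy U = 0" "dz F * dx U - dx F * dz U = 0" "dx F * dy U - dy F * dx U = 0"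
    using 0[THEN fun_cong, of X3] 0[THEN fun_cong, of Y3] 0[THEN fun_cong, of Z3]
    by (simp_all only: bracket_generator)
  then show False using assms by auto
qed

lemma extra_derivation_nonmonomial_factor:
  fixes F G :: "'k::field_char_0 poly3"
  assumes F: "homogeneous a b c p F" "F \<noteq> 0" and G: "homogeneous a b c q G" "G \<noteq> 0" "q > 0"
    and n: "p + q = a + b + c"
    and nonmono: "\<not> (\<exists>r s t \<kappa>. F = const3 \<kappa> * mono3 r s t)"
  shows "\<exists>\<delta>. derivation \<delta> \<and> degree0_map a b c \<delta> \<and> divergence \<delta> = 0 \<and> \<delta> (F * G) = 0 \<and> \<delta> \<noteq> (\<lambda>f. 0)"
proof (cases "(\<lambda>f. bracket G f F) = (\<lambda>f. 0)")
  case False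
  have "bracket G (F * G) F = 0"
    using derivationD(3)[OF derivation_bracket[of G F], of F G] by (simp add: bracket_self)
  then show ?thesis
    using False derivation_bracket degree0_map_bracket[OF F(1) G(1) n] divergence_bracket by blast
next
  case True
  \<comment> \<open>The potential \<open>G\<close> gives the zero field, so a monomial occurring in
    \<open>G\<close>, hence of the same degree, takes its place.\<close>
  obtain i j l where "coeff (coeff (coeff G l) j) i \<noteq> 0"
    using nonzero_coeffE[OF G(2)] .
  then have q: "a * i + b * j + c * l = q"
    using G(1) by (auto simp: homogeneous_def)
  define U :: "'k poly3" where "U = mono3 i j l"
  have U: "homogeneous a b c q U"
    using homogeneous_mono3[of a b c i j l] by (simp add: U_def q)
  \<comment> \<open>The bracket is a determinant of three gradients, so exchanging \<open>U\<close>
    and \<open>G\<close> only changes its sign. Hence the new field annihilates \<open>G\<close> as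
    well.\<close>
  have "bracket U G F = - bracket G U F"
    by (simp add: bracket_eq algebra_simps)
  also have "\<dots> = 0"
    using fun_cong[OF True, of U] by simp
  finally have "bracket U (F * G) F = 0"
    using derivationD(3)[OF derivation_bracket[of U F], of F G] by (simp add: bracket_self)
  then show ?thesis
    using bracket_nonzero[OF monomial_or_independent[OF F(2,1) q G(3) nonmono, folded U_def]]
      derivation_bracket degree0_map_bracket[OF F(1) U n] divergence_bracket by blast
qed

text \<open>A diagonal field with entries \<open>u, v, w\<close> multiplies the monomial by
  \<open>u * i + v * j + w * l\<close> and has divergence \<open>u + v + w\<close>: two linear
  conditions on three unknowns.\<close>

lemma extra_derivation_monomial:
  "\<exists>\<delta>. derivation \<delta> \<and> degree0_map a b c \<delta> \<and> divergence \<delta> = 0 \<and>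
     \<delta> (const3 \<kappa> * mono3 i j l) = 0 \<and> \<delta> \<noteq> (\<lambda>f. 0)"
  for \<kappa> :: "'k::field_char_0"
proof -
  obtain u v w :: 'k where uvw: "u + v + w = 0" "u * of_nat i + v * of_nat j + w * of_nat l = 0"
    and nz: "u \<noteq> 0 \<or> v \<noteq> 0 \<or> w \<noteq> 0"
  proof (cases "i = j \<and> j = l")
    case True
    then show ?thesis using that[of 1 "-1" 0] by simp
  next
    case False
    \<comment> \<open>The witness is the cross product of \<open>(i, j, l)\<close> and
      \<open>(1, 1, 1)\<close>, nonzero because the two are not proportional.\<close>
    then show ?thesis
      using that[of "of_nat j - of_nat l" "of_nat l - of_nat i" "of_nat i - of_nat j"]
      by (auto simp: algebra_simps)
  qed
  let ?\<delta> = "vfield (const3 u * X3) (const3 v * Y3) (const3 w * Z3)"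
  have "divergence ?\<delta> = const3 (u + v + w)"
    by (simp add: divergence_def vfield_generators d_mult d_const3 dx_simps dy_simps dz_simps const3_simps)
  moreover have "?\<delta> (mono3 i j l) = const3 (u * of_nat i + v * of_nat j + w * of_nat l) * mono3 i j l"
    by (simp add: vfield_def mult.assoc log_derivative_mono3 const3_simps distrib_right)
  then have "?\<delta> (const3 \<kappa> * mono3 i j l) = 0"
    by (simp add: derivationD(2)[OF derivation_vfield] uvw const3_simps(3))
  moreover have "degree0_map a b c ?\<delta>"
    by (simp add: degree0_map_iff[OF derivation_vfield] vfield_generators euler_simps euler_generators
        mult.left_commute)
  moreover have "?\<delta> \<noteq> (\<lambda>f. 0)"
  proof
    assume "?\<delta> = (\<lambda>f. 0)"
    from this[THEN fun_cong, of X3] this[THEN fun_cong, of Y3] this[THEN fun_cong, of Z3]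
    have "const3 u * X3 = 0" "const3 v * Y3 = 0" "const3 w * Z3 = 0"
      by (simp_all only: vfield_generators)
    then show False using nz by (auto simp: X3_def Y3_def Z3_def)
  qed
  ultimately show ?thesis
    using derivation_vfield uvw(1) by (metis const3_simps(3))
qed

lemma extra_derivation:
  fixes \<Omega> :: "'k::field_char_0 poly3"
  assumes pos: "a > 0" "b > 0" "c > 0" and \<Omega>: "homogeneous a b c (a + b + c) \<Omega>" "\<Omega> \<noteq> 0"
    and nirr: "\<not> irreducible \<Omega>"
  shows "\<exists>\<delta>. derivation \<delta> \<and> degree0_map a b c \<delta> \<and> divergence \<delta> = 0 \<and> \<delta> \<Omega> = 0 \<and> \<delta> \<noteq> (\<lambda>f. 0)"
proof -
  \<comment> \<open>A unit is constant and killed by the Euler derivation, whereas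
    \<open>\<Omega>\<close> has positive degree.\<close>
  have "\<not> \<Omega> dvd 1"
  proof
    assume "\<Omega> dvd 1"
    then have "\<exists>r. \<Omega> = const3 r"
      by (auto simp: is_unit_poly_iff const3_def elim: degree_eq_zeroE)
    then have "euler a b c \<Omega> = 0"
      by (auto simp: euler_simps)
    then show False
      using \<Omega> pos by (auto simp: homogeneous_iff_euler simp flip: of_nat_add)
  qed
  then obtain F G where "\<Omega> = F * G" "\<not> F dvd 1" "\<not> G dvd 1"
    using nirr \<Omega>(2) by (auto simp: irreducible_def)
  from homogeneous_factors[OF pos \<Omega> this]
  obtain p q F G where FG: "p > 0" "q > 0" "p + q = a + b + c" "homogeneous a b c p F"
    "homogeneous a b c q G" "\<Omega> = F * G" .
  have nz: "F \<noteq> 0" "G \<noteq> 0"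
    using \<Omega>(2) FG(6) by auto
  consider "\<not> (\<exists>r s t \<kappa>. F = const3 \<kappa> * mono3 r s t)" | "\<not> (\<exists>r s t \<kappa>. G = const3 \<kappa> * mono3 r s t)"
    | "(\<exists>r s t \<kappa>. F = const3 \<kappa> * mono3 r s t) \<and> (\<exists>r s t \<kappa>. G = const3 \<kappa> * mono3 r s t)"
    by blast
  then show ?thesis
  proof cases
    case 1
    then show ?thesis
      using extra_derivation_nonmonomial_factor[OF FG(4) nz(1) FG(5) nz(2) FG(2,3)] FG(6) by blast
  next
    case 2
    then show ?thesis
      using extra_derivation_nonmonomial_factor[OF FG(5) nz(2) FG(4) nz(1) FG(1)] FG(3,6)
      by (metis add.commute mult.commute)
  next
    case 3
    then obtain r s t \<kappa> r' s' t' \<kappa>' where "F = const3 \<kappa> * mono3 r s t" "G = const3 \<kappa>' * mono3 r' s' t'"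
      by blast
    then have "\<Omega> = const3 (\<kappa> * \<kappa>') * mono3 (r + r') (s + s') (t + t')"
      by (simp add: FG(6) const3_simps ac_simps flip: mono3_mult)
    then show ?thesis
      using extra_derivation_monomial by metis
  qed
qed

section \<open>The dimension of \<open>Gspd\<close>\<close>

lemma rgt_eq_0_iff: "rgt a b c \<Omega> = 0 \<longleftrightarrow> vector_space.dim scale_map (Gspd a b c \<Omega>) = 1"
  by (simp add: rgt_def)

lemma divergence_scale_map: "divergence (scale_map r \<delta>) = const3 r * divergence \<delta>"
  by (simp add: divergence_def scale_map_def scale3_eq d_mult d_const3 distrib_left)

text \<open>The divergence is linear. On a line through the nonzero \<open>\<delta>\<close> it would
  vanish identically, but on the Euler derivation it equals \<open>a + b + c\<close>.\<close>

lemma dim_Gspd_neq_1: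
  fixes \<Omega> :: "'k::field_char_0 poly3"
  assumes "homogeneous a b c (a + b + c) \<Omega>" "a > 0"
    and \<delta>: "\<delta> \<in> Gspd a b c \<Omega>" "divergence \<delta> = 0" "\<delta> \<noteq> (\<lambda>f. 0)"
  shows "vector_space.dim scale_map (Gspd a b c \<Omega>) \<noteq> 1"
proof
  interpret V: vector_space "scale_map :: 'k \<Rightarrow> _" by (rule vector_space_scale_map)
  assume "V.dim (Gspd a b c \<Omega>) = 1"
  then obtain B where "Gspd a b c \<Omega> \<subseteq> V.span B" "card B = 1"
    using V.basis_exists[of "Gspd a b c \<Omega>"] by metis
  then obtain e where e: "Gspd a b c \<Omega> \<subseteq> V.span {e}"
    by (auto simp: card_1_singleton_iff)
  obtain r s where rs: "euler a b c = scale_map r e" "\<delta> = scale_map s e"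
    using e euler_in_Gspd[OF assms(1)] \<delta>(1) unfolding V.span_singleton by blast
  have "s \<noteq> 0"
    using \<delta>(3) rs(2) by (auto simp: scale_map_def scale3_eq const3_simps)
  then have "divergence e = 0"
    using \<delta>(2) rs(2) by (simp add: divergence_scale_map)
  then have "divergence (euler a b c :: 'k poly3 \<Rightarrow> _) = 0"
    by (simp add: rs(1) divergence_scale_map)
  then show False
    using \<open>a > 0\<close> by (simp add: divergence_euler flip: of_nat_add)
qed

lemma dim_Gspd_eq_1:
  fixes \<Omega> :: "'k::field_char_0 poly3"
  assumes "homogeneous a b c (a + b + c) \<Omega>" "a > 0"
    and "\<And>\<delta>. \<delta> \<in> Gspd a b c \<Omega> \<Longrightarrow> \<exists>r. \<delta> = scale_map r (euler a b c)"
  shows "vector_space.dim scale_map (Gspd a b c \<Omega>) = 1"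
proof -
  interpret V: vector_space "scale_map :: 'k \<Rightarrow> _" by (rule vector_space_scale_map)
  have "euler a b c \<noteq> (0 :: 'k poly3 \<Rightarrow> _)"
  proof
    assume "euler a b c = (0 :: 'k poly3 \<Rightarrow> _)"
    then have "divergence (euler a b c :: 'k poly3 \<Rightarrow> _) = 0"
      by (simp add: divergence_def d_0)
    then show False
      using \<open>a > 0\<close> by (simp add: divergence_euler flip: of_nat_add)
  qed
  then have "V.independent {euler a b c}"
    by simp
  moreover have "{euler a b c} \<subseteq> Gspd a b c \<Omega>"
    using euler_in_Gspd[OF assms(1)] by simp
  moreover have "Gspd a b c \<Omega> \<subseteq> V.span {euler a b c}"
    using assms(3) by (auto simp: V.span_singleton)
  ultimately show ?thesis
    using V.dim_unique[of "{euler a b c}" "Gspd a b c \<Omega>" 1] by simp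
qed

lemma reducible_imp_rgt_nonzero:
  fixes \<Omega> :: "'k::field_char_0 poly3"
  assumes "a > 0" "b > 0" "c > 0" "homogeneous a b c (a + b + c) \<Omega>" "\<Omega> \<noteq> 0" "\<not> irreducible \<Omega>"
  shows "rgt a b c \<Omega> \<noteq> 0"
proof -
  obtain \<delta> where \<delta>: "derivation \<delta>" "degree0_map a b c \<delta>" "divergence \<delta> = 0" "\<delta> \<Omega> = 0" "\<delta> \<noteq> (\<lambda>f. 0)"
    using extra_derivation[OF assms] by blast
  then have "\<delta> \<in> Gspd a b c \<Omega>"
    using semi_poissonI[of \<delta> \<Omega> 0] by (simp add: Gspd_def const3_simps)
  then show ?thesis
    using dim_Gspd_neq_1[OF assms(4,1)] \<delta> by (simp add: rgt_eq_0_iff)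
qed

section \<open>Closed logarithmic forms\<close>

text \<open>Choose a nonzero element of minimal degree in the ideal: if its degree were positive,
  pseudo-division would exhibit it as a common factor of \<open>P\<close> and \<open>g\<close> up to constants.\<close>

lemma elimination:
  fixes P g :: "'b::idom poly"
  assumes P: "prime_elem P" "degree P > 0" and "\<not> P dvd g"
  obtains r u v where "r \<noteq> 0" "[:r:] = u * P + v * g"
proof -
  define J where "J = {h. h \<noteq> 0 \<and> (\<exists>u v. h = u * P + v * g)}"
  have P0: "P \<noteq> 0"
    using P(2) by auto
  moreover have "\<exists>u v. P = u * P + v * g"
    by (rule exI[of _ 1], rule exI[of _ 0]) simp
  ultimately have "P \<in> J"
    by (simp add: J_def)
  then obtain h where h: "h \<in> J" and min: "\<And>h'. h' \<in> J \<Longrightarrow> degree h \<le> degree h'"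
    using ex_has_least_nat[of "\<lambda>h. h \<in> J" P degree] by auto
  obtain u v where uv: "h = u * P + v * g" and "h \<noteq> 0"
    using h by (auto simp: J_def)
  \<comment> \<open>The pseudo-remainder stays in the ideal and has smaller degree, so by minimality
    it is zero.\<close>
  have div: "\<exists>\<kappa> q. \<kappa> \<noteq> 0 \<and> smult \<kappa> f = h * q" if f: "f = s * P + t * g" for f s t
  proof -
    obtain \<kappa> q where q: "\<kappa> \<noteq> 0" "smult \<kappa> f = h * q + pseudo_mod f h"
      using pseudo_mod(1)[OF \<open>h \<noteq> 0\<close>, of f] by auto
    have "pseudo_mod f h = smult \<kappa> f - h * q"
      using q by simp
    also have "\<dots> = (smult \<kappa> s - q * u) * P + (smult \<kappa> t - q * v) * g"
      by (simp add: f uv algebra_simps smult_add_right)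
    finally have "pseudo_mod f h \<in> J" if "pseudo_mod f h \<noteq> 0"
      using that by (auto simp: J_def)
    then have "pseudo_mod f h = 0"
      using pseudo_mod(2)[OF \<open>h \<noteq> 0\<close>, of f] min by fastforce
    with q show ?thesis by auto
  qed
  have "degree h = 0"
  proof (rule ccontr)
    assume deg: "degree h \<noteq> 0"
    obtain \<kappa> q where q: "\<kappa> \<noteq> 0" "smult \<kappa> P = h * q"
      using div[of P 1 0] by auto
    obtain \<mu> q' where q': "\<mu> \<noteq> 0" "smult \<mu> g = h * q'"
      using div[of g 0 1] by auto
    have const: "\<not> P dvd [:\<nu>:]" if "\<nu> \<noteq> 0" for \<nu>
      using P(2) that dvd_imp_degree_le[of P "[:\<nu>:]"] by auto
    \<comment> \<open>From \<open>h * q = smult \<kappa> P\<close> the prime \<open>P\<close>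
      divides \<open>h\<close> or \<open>q\<close>. In the first case it divides \<open>g\<close>;
      in the second, \<open>h\<close> divides the constant \<open>\<kappa>\<close>.\<close>
    have "P dvd h * q"
      unfolding q(2)[symmetric] by (simp add: dvd_smult)
    then consider "P dvd h" | "P dvd q"
      using prime_elem_dvd_multD[OF P(1)] by metis
    then show False
    proof cases
      case 1
      then have "P dvd [:\<mu>:] * g"
        using q'(2) by auto
      then show False
        using prime_elem_dvd_multD[OF P(1)] const[OF q'(1)] \<open>\<not> P dvd g\<close> by metis
    next
      case 2
      then obtain q1 where "q = P * q1" by (elim dvdE)
      then have "P * [:\<kappa>:] = P * (h * q1)"
        using q(2) by (simp add: ac_simps)
      then have "[:\<kappa>:] = h * q1"
        by (rule mult_left_cancel[OF P0, THEN iffD1])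
      then have "degree h + degree q1 = 0" 
        using q(1) by (metis degree_mult_eq degree_pCons_0 mult_zero_left mult_zero_right pCons_eq_0_iff)
      then show False using deg by simp
    qed
  qed
  then obtain r where r: "h = [:r:]" by (elim degree_eq_zeroE)
  show ?thesis
  proof
    show "r \<noteq> 0" using r \<open>h \<noteq> 0\<close> by auto
    show "[:r:] = u * P + v * g" using r uv by simp
  qed
qed

section \<open>Smooth points of the surface\<close>

definition eval3 :: "'k::comm_ring_1 \<Rightarrow> 'k \<Rightarrow> 'k \<Rightarrow> 'k poly3 \<Rightarrow> 'k" where
  "eval3 = subst3 (\<lambda>r. r)"

lemma comm_ring_hom_id: "comm_ring_hom (\<lambda>r. r)"
  by unfold_locales simp_all

lemmas eval3_simps = subst3_simps[OF comm_ring_hom_id, folded eval3_def]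

lemma nonvanishing_point:
  fixes p :: "'k::field_char_0 poly poly"
  assumes "p \<noteq> 0"
  obtains x y where "poly (map_poly (\<lambda>q. poly q x) p) y \<noteq> 0"
proof -
  obtain x where x: "poly (lead_coeff p) x \<noteq> 0"
    using assms poly_all_0_iff_0[of "lead_coeff p"] by auto
  then have "coeff (map_poly (\<lambda>q. poly q x) p) (degree p) \<noteq> 0"
    by (simp add: coeff_map_poly)
  then have "map_poly (\<lambda>q. poly q x) p \<noteq> 0"
    by (metis coeff_0)
  then show ?thesis
    using that poly_all_0_iff_0 by blast
qed

text \<open>Eliminating z from \<open>\<Omega>\<close> and \<open>dz \<Omega>\<close> yields a
  nonzero \<open>r\<close> in x and y, in the role of the discriminant. Over a point where neither
  \<open>r\<close> nor the leading coefficient in z vanishes, algebraic closedness gives a root z of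
  \<open>\<Omega>\<close>, and \<open>dz \<Omega>\<close> cannot vanish there too.\<close>

lemma smooth_point:
  fixes \<Omega> :: "'k::{alg_closed_field, field_char_0} poly3"
  assumes "irreducible \<Omega>" "dz \<Omega> \<noteq> 0"
  obtains x y z where "eval3 x y z \<Omega> = 0" "eval3 x y z (dz \<Omega>) \<noteq> 0"
proof -
  have deg: "degree \<Omega> > 0"
    using assms(2) by (auto simp: dz_def pderiv_eq_0_iff)
  have "\<not> \<Omega> dvd dz \<Omega>"
    using dvd_imp_degree_le[of \<Omega> "dz \<Omega>"] assms(2) deg by (auto simp: dz_def degree_pderiv)
  then obtain r u v where r: "r \<noteq> 0" "[:r:] = u * \<Omega> + v * dz \<Omega>"
    using elimination[of \<Omega> "dz \<Omega>"] assms(1) deg by (metis prime_elem_iff_irreducible)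
  have "r * lead_coeff \<Omega> \<noteq> 0"
    using r(1) deg by auto
  then obtain x y where xy: "poly (map_poly (\<lambda>q. poly q x) (r * lead_coeff \<Omega>)) y \<noteq> 0"
    using nonvanishing_point by blast
  define e where "e = (\<lambda>p. poly (map_poly (\<lambda>q. poly q x) p) y)"
  have eval3: "eval3 x y z f = poly (map_poly e f) z" for z f
    by (simp add: eval3_def subst3_def e_def)
  have "comm_ring_hom e"
    unfolding e_def
    by (intro comm_ring_hom_eval) (unfold_locales; simp)
  then interpret e: comm_ring_hom e .
  have nz: "e r \<noteq> 0" "e (lead_coeff \<Omega>) \<noteq> 0"
  proof -
    have "e (r * lead_coeff \<Omega>) \<noteq> 0"
      unfolding e_def by (rule xy)
    then have "e r * e (lead_coeff \<Omega>) \<noteq> 0"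
      unfolding e.hom_mult .
    then show "e r \<noteq> 0" "e (lead_coeff \<Omega>) \<noteq> 0"
      by auto
  qed
  have "coeff (map_poly e \<Omega>) (degree \<Omega>) \<noteq> 0"
    using nz(2) by (simp add: coeff_map_poly)
  then have "degree (map_poly e \<Omega>) > 0"
    using deg le_degree by (metis gr0I le_zero_eq not_gr0)
  then obtain z where "poly (map_poly e \<Omega>) z = 0"
    using alg_closed_imp_poly_has_root by blast
  then have z: "eval3 x y z \<Omega> = 0"
    by (simp add: eval3)
  have "eval3 x y z [:r:] = e r"
    using nz(1) by (cases "r = 0") (simp_all add: eval3 map_poly_pCons)
  then have "eval3 x y z (dz \<Omega>) \<noteq> 0"
    using nz(1) z unfolding r(2) by (auto simp: eval3_simps)
  with z that show ?thesis by blast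
qed

text \<open>\<open>local_ideal \<Omega> d w\<close> is the contraction of the ideal \<open>(\<Omega>, w)\<close> from the
  localisation at \<open>d\<close>.\<close>

definition local_ideal :: "'r::comm_ring_1 \<Rightarrow> 'r \<Rightarrow> 'r \<Rightarrow> 'r set" where
  "local_ideal \<Omega> d w = {f. \<exists>N s t. d ^ N * f = s * \<Omega> + t * w}"

lemma local_ideal_cancel:
  assumes "d * f \<in> local_ideal \<Omega> d w"
  shows "f \<in> local_ideal \<Omega> d w"
proof -
  obtain N s t where "d ^ N * (d * f) = s * \<Omega> + t * w"
    using assms by (auto simp: local_ideal_def)
  then have "d ^ Suc N * f = s * \<Omega> + t * w"
    by (simp add: mult.assoc mult.left_commute)
  then show ?thesis
    unfolding local_ideal_def by blast
qed

text \<open>The extra factor \<open>f\<close> avoids the exponent \<open>n - 1\<close>.\<close>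

lemma derivation_power:
  assumes "derivation \<delta>"
  shows "f * \<delta> (f ^ n) = of_nat n * f ^ n * \<delta> f"
proof (induction n)
  case 0
  show ?case using derivation_of_nat(1)[OF assms, of 1] by simp
next
  case (Suc n)
  have "f * \<delta> (f ^ Suc n) = f * \<delta> f * f ^ n + f * (f * \<delta> (f ^ n))"
    by (simp add: derivationD(3)[OF assms] algebra_simps)
  also have "\<dots> = of_nat (Suc n) * f ^ Suc n * \<delta> f"
    unfolding Suc by (simp add: algebra_simps)
  finally show ?case .
qed

text \<open>This is the quotient rule: differentiating \<open>d ^ N * f\<close> leaves a multiple of
  \<open>d ^ (N - 1) * f\<close>, which one more factor \<open>d\<close> brings back into the
  ideal.\<close>

lemma local_ideal_derivation:
  assumes \<delta>: "derivation \<delta>" and "\<delta> \<Omega> = 0" and w: "d * \<delta> w = p * \<Omega> + q * w"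
    and f: "f \<in> local_ideal \<Omega> d w"
  shows "\<delta> f \<in> local_ideal \<Omega> d w"
proof -
  obtain N s t where e: "d ^ N * f = s * \<Omega> + t * w"
    using f by (auto simp: local_ideal_def)
  have "d * \<delta> (d ^ N * f) = of_nat N * d ^ N * \<delta> d * f + d ^ Suc N * \<delta> f"
    using derivation_power[OF \<delta>, of d N]
    by (simp add: derivationD(3)[OF \<delta>] distrib_left mult.assoc[symmetric])
  moreover have "d * \<delta> (s * \<Omega> + t * w) = d * \<delta> s * \<Omega> + d * \<delta> t * w + t * (d * \<delta> w)"
    by (simp add: derivationD[OF \<delta>] assms(2) algebra_simps)
  moreover have "of_nat N * d ^ N * \<delta> d * f = of_nat N * \<delta> d * (s * \<Omega> + t * w)"
    unfolding e[symmetric] by (simp only: ac_simps)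
  ultimately have "d ^ Suc N * \<delta> f =
      (d * \<delta> s + t * p - of_nat N * \<delta> d * s) * \<Omega> + (d * \<delta> t + t * q - of_nat N * \<delta> d * t) * w"
    unfolding e w by (simp add: algebra_simps)
  then show ?thesis
    unfolding local_ideal_def by blast
qed

text \<open>The vector field \<open>dz \<Omega> * D - D \<Omega> * dz\<close>, with \<open>D\<close> one of \<open>dx, dy\<close>, is tangent to the surface
  \<open>\<Omega> = 0\<close>, and modulo \<open>\<Omega>\<close> it annihilates the residue \<open>w3 / dz \<Omega>\<close>.\<close>

lemma tangent_derivative_residue:
  fixes \<Omega> w w3 :: "'k::field poly3"
  assumes D: "derivation D" "\<And>f. dz (D f) = D (dz f)"
    and eq: "dz \<Omega> * w - D \<Omega> * w3 = \<Omega> * (dz w - D w3)"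
  shows "\<exists>p q. dz \<Omega> * (dz \<Omega> * D w3 - D \<Omega> * dz w3) = p * \<Omega> + q * w3"
proof -
  let ?B = "dz w - D w3"
  have "dz (dz \<Omega>) * w + dz \<Omega> * dz w - (D (dz \<Omega>) * w3 + D \<Omega> * dz w3) = dz \<Omega> * ?B + \<Omega> * dz ?B"
    using arg_cong[OF eq, of dz] by (simp only: d_diff d_mult D(2))
  then have X: "dz \<Omega> * D w3 - D \<Omega> * dz w3 = \<Omega> * dz ?B + D (dz \<Omega>) * w3 - dz (dz \<Omega>) * w"
    by (simp add: algebra_simps) algebra
  \<comment> \<open>In \<open>X\<close> only the term in \<open>w\<close> is outside the ideal; a
    further factor \<open>dz \<Omega>\<close> lets \<open>eq\<close> rewrite it.\<close>
  have "dz \<Omega> * (dz \<Omega> * D w3 - D \<Omega> * dz w3) =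
      dz \<Omega> * \<Omega> * dz ?B + dz \<Omega> * D (dz \<Omega>) * w3 - dz (dz \<Omega>) * (dz \<Omega> * w)"
    unfolding X by (simp only: algebra_simps)
  also have "dz \<Omega> * w = D \<Omega> * w3 + \<Omega> * ?B"
    using eq by (simp only: algebra_simps)
  also have "dz \<Omega> * \<Omega> * dz ?B + dz \<Omega> * D (dz \<Omega>) * w3 - dz (dz \<Omega>) * (D \<Omega> * w3 + \<Omega> * ?B) =
      (dz \<Omega> * dz ?B - dz (dz \<Omega>) * ?B) * \<Omega> + (dz \<Omega> * D (dz \<Omega>) - dz (dz \<Omega>) * D \<Omega>) * w3"
    by (simp only: algebra_simps)
  finally show ?thesis by blast
qed

text \<open>In characteristic zero, differentiating in y and then in x lowers the degree step by
  step without reaching zero before a constant.\<close>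

lemma local_ideal_contains_const:
  fixes I :: "'k::field_char_0 poly3 set"
  assumes dx: "\<And>r. [:r:] \<in> I \<Longrightarrow> dx [:r:] \<in> I" and dy: "\<And>r. [:r:] \<in> I \<Longrightarrow> dy [:r:] \<in> I"
    and "r \<noteq> 0" "[:r:] \<in> I"
  shows "\<exists>\<kappa>. \<kappa> \<noteq> 0 \<and> const3 \<kappa> \<in> I"
proof -
  have y: "\<exists>s. s \<noteq> 0 \<and> [:[:s:]:] \<in> I" if "r \<noteq> 0" "[:r:] \<in> I" for r
    using that
  proof (induction "degree r" arbitrary: r rule: less_induct)
    case less
    show ?case
    proof (cases "degree r = 0")
      case True
      then show ?thesis using less by (auto elim!: degree_eq_zeroE)
    next
      case False
      have "dy [:r:] = [:pderiv r:]"
        by (cases "r = 0") (simp_all add: dy_def map_poly_pCons)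
      then have "[:pderiv r:] \<in> I"
        using dy[of r] less(3) by simp
      moreover have "pderiv r \<noteq> 0" "degree (pderiv r) < degree r"
        using False by (auto simp: pderiv_eq_0_iff degree_pderiv)
      ultimately show ?thesis using less(1) by blast
    qed
  qed
  have x: "\<exists>\<kappa>. \<kappa> \<noteq> 0 \<and> [:[:[:\<kappa>:]:]:] \<in> I" if "s \<noteq> 0" "[:[:s:]:] \<in> I" for s
    using that
  proof (induction "degree s" arbitrary: s rule: less_induct)
    case less
    show ?case
    proof (cases "degree s = 0")
      case True
      then show ?thesis using less by (auto elim!: degree_eq_zeroE)
    next
      case False
      have "dx [:[:s:]:] = [:[:pderiv s:]:]"
        by (cases "s = 0") (simp_all add: dx_def map_poly_pCons)
      then have "[:[:pderiv s:]:] \<in> I"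
        using dx[of "[:s:]"] less(3) by simp
      moreover have "pderiv s \<noteq> 0" "degree (pderiv s) < degree s"
        using False by (auto simp: pderiv_eq_0_iff degree_pderiv)
      ultimately show ?thesis using less(1) by blast
    qed
  qed
  show ?thesis
    unfolding const3_def using y[OF assms(3,4)] x by blast
qed

text \<open>Otherwise elimination puts a nonzero polynomial in x and y into the contracted ideal. On
  such polynomials the tangent fields act as \<open>dz \<Omega>\<close> times \<open>dx\<close> or
  \<open>dy\<close>, and \<open>dz \<Omega>\<close> cancels, so the ideal is stable under both and
  contains a nonzero constant. Evaluation at the given point, a common zero of
  \<open>\<Omega>\<close> and \<open>w3\<close> but not of \<open>dz \<Omega>\<close>, refutes
  this.\<close>

lemma residue_vanishes:
  fixes \<Omega> :: "'k::field_char_0 poly3"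
  assumes "irreducible \<Omega>" "dz \<Omega> \<noteq> 0"
    and X: "dz \<Omega> * w1 - dx \<Omega> * w3 = \<Omega> * (dz w1 - dx w3)"
    and Y: "dz \<Omega> * w2 - dy \<Omega> * w3 = \<Omega> * (dz w2 - dy w3)"
    and pt: "eval3 x y z \<Omega> = 0" "eval3 x y z (dz \<Omega>) \<noteq> 0" "eval3 x y z w3 = 0"
  shows "\<Omega> dvd w3"
proof (rule ccontr)
  assume ndvd: "\<not> \<Omega> dvd w3"
  let ?I = "local_ideal \<Omega> (dz \<Omega>) w3"
  have deg: "degree \<Omega> > 0"
    using assms(2) by (auto simp: dz_def pderiv_eq_0_iff)
  obtain r u v where r: "r \<noteq> 0" "[:r:] = u * \<Omega> + v * w3"
    using elimination[OF _ deg ndvd] assms(1) by auto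
  have tangent: "D [:r:] \<in> ?I"
    if D: "derivation D" "\<And>f. dz (D f) = D (dz f)"
      and eq: "dz \<Omega> * w - D \<Omega> * w3 = \<Omega> * (dz w - D w3)" and r: "[:r:] \<in> ?I" for D w r
  proof -
    let ?\<delta> = "\<lambda>f. dz \<Omega> * D f - D \<Omega> * dz f"
    have \<delta>: "derivation ?\<delta>"
      by (rule derivationI) (simp_all add: derivationD[OF D(1)] d_add d_mult d_const3 algebra_simps)
    obtain p q where pq: "dz \<Omega> * ?\<delta> w3 = p * \<Omega> + q * w3"
      using tangent_derivative_residue[OF D eq] by blast
    have "?\<delta> [:r:] \<in> ?I"
      by (rule local_ideal_derivation[OF \<delta> _ pq r]) (simp add: mult.commute)
    moreover have "dz [:r:] = 0"
      by (simp add: dz_def pderiv_pCons)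
    ultimately have "dz \<Omega> * D [:r:] \<in> ?I"
      by simp
    then show ?thesis
      by (rule local_ideal_cancel)
  qed
  have dxy: "derivation dx" "derivation dy"
    by (rule derivationI; simp add: d_add d_mult d_const3)+
  have "dz \<Omega> ^ 0 * [:r:] = u * \<Omega> + v * w3"
    using r(2) by simp
  then have rI: "[:r:] \<in> ?I"
    unfolding local_ideal_def by blast
  obtain \<kappa> where "\<kappa> \<noteq> 0" "const3 \<kappa> \<in> ?I"
    using local_ideal_contains_const[OF tangent[OF dxy(1) d_commute(2) X]
        tangent[OF dxy(2) d_commute(3) Y] r(1) rI] by blast
  then obtain N s t where e: "dz \<Omega> ^ N * const3 \<kappa> = s * \<Omega> + t * w3"
    by (auto simp: local_ideal_def)
  have "eval3 x y z (dz \<Omega>) ^ N * \<kappa> = 0"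
    using arg_cong[OF e, of "eval3 x y z"] pt by (simp add: eval3_simps)
  then show False
    using \<open>\<kappa> \<noteq> 0\<close> pt(2) by simp
qed

text \<open>Exchanging y and z lets the case \<open>dz \<Omega> = 0\<close>,
  \<open>dy \<Omega> \<noteq> 0\<close> be reduced to a nonzero z-derivative.\<close>

definition swap_yz :: "'k::field poly3 \<Rightarrow> 'k poly3" where
  "swap_yz = subst3 const3 X3 Z3 Y3"

lemma comm_ring_hom_const3: "comm_ring_hom (const3 :: 'k::field \<Rightarrow> _)"
  by unfold_locales (simp_all add: const3_simps)

lemmas swap_yz_simps = subst3_simps[OF comm_ring_hom_const3, of X3 Z3 Y3, folded swap_yz_def]

lemma swap_yz_swap_yz [simp]: "swap_yz (swap_yz f) = f"
  by (induction f rule: poly3_induct) (simp_all add: swap_yz_simps)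

lemma d_swap_yz:
  "dx (swap_yz f) = swap_yz (dx f)" "dy (swap_yz f) = swap_yz (dz f)" "dz (swap_yz f) = swap_yz (dy f)"
proof -
  have 1: "swap_yz 1 = (1 :: 'a poly3)"
    using swap_yz_simps(9)[of 1] by simp
  show "dx (swap_yz f) = swap_yz (dx f)" "dy (swap_yz f) = swap_yz (dz f)" "dz (swap_yz f) = swap_yz (dy f)"
    by (induction f rule: poly3_induct;
        simp add: swap_yz_simps 1 d_const3 dx_simps dy_simps dz_simps d_add d_mult)+
qed

lemma swap_yz_dvd_iff: "swap_yz f dvd swap_yz g \<longleftrightarrow> f dvd g"
proof
  assume "f dvd g"
  then show "swap_yz f dvd swap_yz g"
    by (auto simp: swap_yz_simps)
next
  assume "swap_yz f dvd swap_yz g"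
  then obtain h where "swap_yz g = swap_yz f * h" by (elim dvdE)
  then have "swap_yz (swap_yz g) = swap_yz (swap_yz f * h)" by simp
  then show "f dvd g"
    by (simp only: swap_yz_simps swap_yz_swap_yz) simp
qed

lemma irreducible_swap_yz:
  assumes "irreducible \<Omega>"
  shows "irreducible (swap_yz \<Omega>)"
proof (rule irreducibleI)
  have 1: "swap_yz 1 = (1 :: 'a poly3)"
    using swap_yz_simps(9)[of 1] by simp
  have unit: "swap_yz f dvd 1 \<longleftrightarrow> f dvd 1" for f :: "'a poly3"
    using swap_yz_dvd_iff[of f 1] by (simp only: 1)
  show "swap_yz \<Omega> \<noteq> 0"
    using assms swap_yz_swap_yz[of \<Omega>] swap_yz_simps(8) by (metis not_irreducible_zero)
  show "\<not> swap_yz \<Omega> dvd 1"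
    using assms unit irreducible_not_unit by blast
  fix f g
  assume "swap_yz \<Omega> = f * g"
  then have "\<Omega> = swap_yz f * swap_yz g"
    by (metis swap_yz_simps(6) swap_yz_swap_yz)
  then show "f dvd 1 \<or> g dvd 1"
    using irreducibleD[OF assms] unit by blast
qed

text \<open>Take \<open>r\<close> to be the value of the residue \<open>w3 / dz \<Omega>\<close> at
  a smooth point. Subtracting \<open>r\<close> times the gradient preserves the equations and makes
  the third component vanish at that point, so \<open>\<Omega>\<close> divides it. As
  \<open>\<Omega>\<close> is prime and does not divide \<open>dz \<Omega>\<close>, the equations
  pass divisibility on to the other components.\<close>

lemma log_form_normal_form_z:
  fixes \<Omega> :: "'k::{alg_closed_field, field_char_0} poly3"
  assumes irr: "irreducible \<Omega>" and nz: "dz \<Omega> \<noteq> 0"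
    and X: "dz \<Omega> * w1 - dx \<Omega> * w3 = \<Omega> * (dz w1 - dx w3)"
    and Y: "dz \<Omega> * w2 - dy \<Omega> * w3 = \<Omega> * (dz w2 - dy w3)"
  shows "\<exists>r u1 u2 u3. w1 = const3 r * dx \<Omega> + \<Omega> * u1 \<and> w2 = const3 r * dy \<Omega> + \<Omega> * u2 \<and>
    w3 = const3 r * dz \<Omega> + \<Omega> * u3"
proof -
  obtain x y z where pt: "eval3 x y z \<Omega> = 0" "eval3 x y z (dz \<Omega>) \<noteq> 0"
    using smooth_point[OF irr nz] .
  define r where "r = eval3 x y z w3 / eval3 x y z (dz \<Omega>)"
  define v1 v2 v3 where v: "v1 = w1 - const3 r * dx \<Omega>" "v2 = w2 - const3 r * dy \<Omega>" "v3 = w3 - const3 r * dz \<Omega>"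
  have X': "dz \<Omega> * v1 - dx \<Omega> * v3 = \<Omega> * (dz v1 - dx v3)"
    and Y': "dz \<Omega> * v2 - dy \<Omega> * v3 = \<Omega> * (dz v2 - dy v3)"
    using X Y by (simp_all add: v d_diff d_mult d_const3 d_commute algebra_simps)
  have "eval3 x y z v3 = 0"
    using pt(2) by (simp add: v r_def eval3_simps)
  then have 3: "\<Omega> dvd v3"
    using residue_vanishes[OF irr nz X' Y' pt] by simp
  have "degree \<Omega> > 0"
    using nz by (auto simp: dz_def pderiv_eq_0_iff)
  then have "\<not> \<Omega> dvd dz \<Omega>"
    using dvd_imp_degree_le[of \<Omega> "dz \<Omega>"] nz by (auto simp: dz_def degree_pderiv)
  then have cancel: "\<Omega> dvd f" if "\<Omega> dvd dz \<Omega> * f" for f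
    using that irr prime_elem_dvd_multD[of \<Omega> "dz \<Omega>" f] by simp
  have "dz \<Omega> * v1 = dx \<Omega> * v3 + \<Omega> * (dz v1 - dx v3)" "dz \<Omega> * v2 = dy \<Omega> * v3 + \<Omega> * (dz v2 - dy v3)"
    using X' Y' by (simp_all only: algebra_simps)
  then have "\<Omega> dvd dz \<Omega> * v1" "\<Omega> dvd dz \<Omega> * v2"
    using 3 by simp_all
  then have "\<Omega> dvd v1" "\<Omega> dvd v2"
    by (auto intro: cancel)
  with 3 obtain u1 u2 u3 where "v1 = \<Omega> * u1" "v2 = \<Omega> * u2" "v3 = \<Omega> * u3"
    by (elim dvdE) blast
  then have "w1 = const3 r * dx \<Omega> + \<Omega> * u1" "w2 = const3 r * dy \<Omega> + \<Omega> * u2"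
    "w3 = const3 r * dz \<Omega> + \<Omega> * u3"
    unfolding v by (simp_all add: diff_eq_eq add.commute)
  then show ?thesis by blast
qed

text \<open>The equations say that \<open>w / \<Omega>\<close> is a closed rational 1-form with a simple pole along
  \<open>\<Omega> = 0\<close>; the constant \<open>r\<close> is its residue.\<close>

lemma log_form_normal_form:
  fixes \<Omega> :: "'k::{alg_closed_field, field_char_0} poly3"
  assumes irr: "irreducible \<Omega>" and nz: "dy \<Omega> \<noteq> 0 \<or> dz \<Omega> \<noteq> 0"
    and yz: "dy \<Omega> * w3 - dz \<Omega> * w2 = \<Omega> * (dy w3 - dz w2)"
    and zx: "dz \<Omega> * w1 - dx \<Omega> * w3 = \<Omega> * (dz w1 - dx w3)"
    and xy: "dx \<Omega> * w2 - dy \<Omega> * w1 = \<Omega> * (dx w2 - dy w1)"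
  shows "\<exists>r u1 u2 u3. w1 = const3 r * dx \<Omega> + \<Omega> * u1 \<and> w2 = const3 r * dy \<Omega> + \<Omega> * u2 \<and>
    w3 = const3 r * dz \<Omega> + \<Omega> * u3"
proof (cases "dz \<Omega> = 0")
  case False
  have neg: "u - v = s * (p - q) \<Longrightarrow> v - u = s * (q - p)" for u v s p q :: "'k poly3"
    by (simp add: algebra_simps)
  show ?thesis
    by (rule log_form_normal_form_z[OF irr False zx neg[OF yz]])
next
  case True
  \<comment> \<open>In the exchanged coordinates \<open>w2\<close> and \<open>w3\<close> trade
    places, and \<open>xy\<close> takes the role of \<open>zx\<close>.\<close>
  define \<Omega>' where "\<Omega>' = swap_yz \<Omega>"
  have "dy \<Omega> \<noteq> 0" using nz True by simp
  then have nz': "dz \<Omega>' \<noteq> 0"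
    unfolding \<Omega>'_def d_swap_yz by (metis swap_yz_simps(8) swap_yz_swap_yz)
  have "dz \<Omega>' * swap_yz w1 - dx \<Omega>' * swap_yz w2 = \<Omega>' * (dz (swap_yz w1) - dx (swap_yz w2))"
    using arg_cong[OF xy, of swap_yz]
    by (simp add: \<Omega>'_def d_swap_yz swap_yz_simps algebra_simps)
  moreover have "dz \<Omega>' * swap_yz w3 - dy \<Omega>' * swap_yz w2 = \<Omega>' * (dz (swap_yz w3) - dy (swap_yz w2))"
    using arg_cong[OF yz, of swap_yz]
    by (simp add: \<Omega>'_def d_swap_yz swap_yz_simps algebra_simps)
  ultimately obtain r u1 u2 u3 where
    "swap_yz w1 = const3 r * dx \<Omega>' + \<Omega>' * u1" "swap_yz w3 = const3 r * dy \<Omega>' + \<Omega>' * u2"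
    "swap_yz w2 = const3 r * dz \<Omega>' + \<Omega>' * u3"
    using log_form_normal_form_z[OF irreducible_swap_yz[OF irr, folded \<Omega>'_def] nz'] by blast
  from this[THEN arg_cong, of swap_yz]
  have "w1 = const3 r * dx \<Omega> + \<Omega> * swap_yz u1" "w3 = const3 r * dz \<Omega> + \<Omega> * swap_yz u2"
    "w2 = const3 r * dy \<Omega> + \<Omega> * swap_yz u3"
    by (simp_all add: \<Omega>'_def d_swap_yz swap_yz_simps)
  then show ?thesis by blast
qed

section \<open>Irreducible potentials\<close>

text \<open>Were both derivatives zero, the Euler identity would make \<open>X3\<close> a factor;
  irreducibility leaves a constant multiple of \<open>X3\<close>, of degree
  \<open>a < n\<close>.\<close>

lemma irreducible_depends_on_yz:
  fixes \<Omega> :: "'k::field_char_0 poly3"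
  assumes "irreducible \<Omega>" "homogeneous a b c n \<Omega>" "n > a" "a > 0" "b > 0" "c > 0"
  shows "dy \<Omega> \<noteq> 0 \<or> dz \<Omega> \<noteq> 0"
proof (rule ccontr)
  assume "\<not> ?thesis"
  then have "of_nat a * X3 * dx \<Omega> = of_nat n * \<Omega>"
    using assms(2) by (simp add: homogeneous_iff_euler euler_def)
  moreover have "X3 * (const3 (inverse (of_nat n)) * of_nat a * dx \<Omega>) =
      const3 (inverse (of_nat n)) * (of_nat a * X3 * dx \<Omega>)"
    by (simp only: ac_simps)
  moreover have "const3 (inverse (of_nat n)) * (of_nat n * \<Omega>) = const3 (inverse (of_nat n) * of_nat n) * \<Omega>"
    by (simp add: const3_simps mult.assoc)
  ultimately have "X3 * (const3 (inverse (of_nat n)) * of_nat a * dx \<Omega>) = \<Omega>"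
    using assms(3) by (simp add: const3_simps(4))
  then obtain g where g: "\<Omega> = X3 * g" by metis
  have "\<not> X3 dvd (1 :: 'k poly3)"
    by (simp add: X3_def is_unit_poly_iff)
  then have "g dvd 1"
    using irreducibleD[OF assms(1) g] by blast
  then obtain r where "g = const3 r"
    by (auto simp: is_unit_poly_iff const3_def elim: degree_eq_zeroE)
  then have "euler a b c \<Omega> = of_nat a * \<Omega>"
    by (simp add: g euler_simps euler_generators mult.assoc)
  then have "of_nat a * \<Omega> = of_nat n * \<Omega>"
    using assms(2) by (simp add: homogeneous_iff_euler)
  then show False
    using assms(1,3) by (simp add: mult_cancel_right)
qed

text \<open>The operator multiplies each monomial by \<open>m\<close> plus its degree, which is
  positive.\<close>

lemma euler_eigen_zero:
  fixes u :: "'k::field_char_0 poly3"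
  assumes "of_nat m * u + euler a b c u = 0" "m > 0"
  shows "u = 0"
proof (rule poly3_eqI)
  fix l j i
  have "of_nat (m + (a * i + b * j + c * l)) * coeff (coeff (coeff u l) j) i = 0"
    using arg_cong[OF assms(1), of "\<lambda>g. coeff (coeff (coeff g l) j) i"]
    by (simp only: coeff_add coeff_euler coeff_const3_mult const3_simps(6)[symmetric] coeff_0 of_nat_add
        distrib_right)
  then have "coeff (coeff (coeff u l) j) i = 0"
    using \<open>m > 0\<close> by (simp only: mult_eq_0_iff of_nat_eq_0_iff) simp
  then show "coeff (coeff (coeff u l) j) i = coeff (coeff (coeff 0 l) j) i"
    by simp
qed

lemma divergence_free_rigidity:
  fixes \<Omega> :: "'k::{alg_closed_field, field_char_0} poly3"
  assumes pos: "a > 0" "b > 0" "c > 0" and \<Omega>: "homogeneous a b c (a + b + c) \<Omega>" and irr: "irreducible \<Omega>"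
    and E: "euler a b c v1 = of_nat a * v1" "euler a b c v2 = of_nat b * v2" "euler a b c v3 = of_nat c * v3"
    and div: "dx v1 + dy v2 + dz v3 = 0" and tangent: "v1 * dx \<Omega> + v2 * dy \<Omega> + v3 * dz \<Omega> = 0"
  shows "v1 = 0 \<and> v2 = 0 \<and> v3 = 0"
proof -
  let ?n = "of_nat (a + b + c) :: 'k poly3"
  define x y z :: "'k poly3" where xyz: "x = of_nat a * X3" "y = of_nat b * Y3" "z = of_nat c * Z3"
  have dxyz: "dx x = of_nat a" "dy y = of_nat b" "dz z = of_nat c" "dx y = 0" "dx z = 0"
    "dy x = 0" "dy z = 0" "dz x = 0" "dz y = 0"
    by (simp_all add: xyz d_mult d_of_nat dx_simps dy_simps dz_simps)
  have euler: "euler a b c f = x * dx f + y * dy f + z * dz f" for f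
    by (simp add: euler_def xyz)
  define w1 w2 w3 where w: "w1 = y * v3 - z * v2" "w2 = z * v1 - x * v3" "w3 = x * v2 - y * v1"
  note E' = E[unfolded euler]
  have curl: "dy w3 - dz w2 = - ?n * v1" "dz w1 - dx w3 = - ?n * v2" "dx w2 - dy w1 = - ?n * v3"
  proof -
    \<comment> \<open>Expansion of the curl of a cross product. With zero divergence and the Euler
      eigenvalues of the \<open>v\<close> components, all contributions add up to
      \<open>- ?n\<close> times the field.\<close>
    have "dy w3 - dz w2 = x * (dx v1 + dy v2 + dz v3) - (x * dx v1 + y * dy v1 + z * dz v1)
        - (of_nat b + of_nat c) * v1"
      "dz w1 - dx w3 = y * (dx v1 + dy v2 + dz v3) - (x * dx v2 + y * dy v2 + z * dz v2)
        - (of_nat a + of_nat c) * v2"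
      "dx w2 - dy w1 = z * (dx v1 + dy v2 + dz v3) - (x * dx v3 + y * dy v3 + z * dz v3)
        - (of_nat a + of_nat b) * v3"
      by (simp_all add: w d_diff d_mult dxyz algebra_simps)
    then show "dy w3 - dz w2 = - ?n * v1" "dz w1 - dx w3 = - ?n * v2" "dx w2 - dy w1 = - ?n * v3"
      unfolding div E' by (simp_all add: algebra_simps)
  qed
  have grad: "x * dx \<Omega> + y * dy \<Omega> + z * dz \<Omega> = ?n * \<Omega>"
    using \<Omega> by (simp add: homogeneous_iff_euler euler)
  have cross: "dy \<Omega> * w3 - dz \<Omega> * w2 = \<Omega> * (dy w3 - dz w2)"
    "dz \<Omega> * w1 - dx \<Omega> * w3 = \<Omega> * (dz w1 - dx w3)"
    "dx \<Omega> * w2 - dy \<Omega> * w1 = \<Omega> * (dx w2 - dy w1)"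
  proof -
    \<comment> \<open>The triple product identity for the gradient of \<open>\<Omega>\<close>
      crossed with \<open>(x, y, z) \<times> (v1, v2, v3)\<close>.\<close>
    have "dy \<Omega> * w3 - dz \<Omega> * w2 =
        x * (v1 * dx \<Omega> + v2 * dy \<Omega> + v3 * dz \<Omega>) - v1 * (x * dx \<Omega> + y * dy \<Omega> + z * dz \<Omega>)"
      "dz \<Omega> * w1 - dx \<Omega> * w3 =
        y * (v1 * dx \<Omega> + v2 * dy \<Omega> + v3 * dz \<Omega>) - v2 * (x * dx \<Omega> + y * dy \<Omega> + z * dz \<Omega>)"
      "dx \<Omega> * w2 - dy \<Omega> * w1 =
        z * (v1 * dx \<Omega> + v2 * dy \<Omega> + v3 * dz \<Omega>) - v3 * (x * dx \<Omega> + y * dy \<Omega> + z * dz \<Omega>)"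
      by (simp_all add: w algebra_simps)
    then show "dy \<Omega> * w3 - dz \<Omega> * w2 = \<Omega> * (dy w3 - dz w2)"
      "dz \<Omega> * w1 - dx \<Omega> * w3 = \<Omega> * (dz w1 - dx w3)"
      "dx \<Omega> * w2 - dy \<Omega> * w1 = \<Omega> * (dx w2 - dy w1)"
      unfolding curl tangent grad by (simp_all add: algebra_simps)
  qed
  obtain r u1 u2 u3 where u: "w1 = const3 r * dx \<Omega> + \<Omega> * u1" "w2 = const3 r * dy \<Omega> + \<Omega> * u2"
    "w3 = const3 r * dz \<Omega> + \<Omega> * u3"
    using log_form_normal_form[OF irr irreducible_depends_on_yz[OF irr \<Omega> _ pos] cross] pos by auto
  have "\<Omega> \<noteq> 0" using irr by auto
  have closed: "dy u3 = dz u2" "dz u1 = dx u3" "dx u2 = dy u1"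
  proof -
    \<comment> \<open>A gradient has zero curl, so \<open>r\<close> drops out, and the terms with
      first derivatives of \<open>\<Omega>\<close> cancel.\<close>
    have "\<Omega> * (\<Omega> * (dy u3 - dz u2)) = \<Omega> * (dy w3 - dz w2) - (dy \<Omega> * w3 - dz \<Omega> * w2)"
      "\<Omega> * (\<Omega> * (dz u1 - dx u3)) = \<Omega> * (dz w1 - dx w3) - (dz \<Omega> * w1 - dx \<Omega> * w3)"
      "\<Omega> * (\<Omega> * (dx u2 - dy u1)) = \<Omega> * (dx w2 - dy w1) - (dx \<Omega> * w2 - dy \<Omega> * w1)"
      unfolding u by (simp_all add: d_add d_mult d_const3 d_commute algebra_simps)
    then show "dy u3 = dz u2" "dz u1 = dx u3" "dx u2 = dy u1"
      unfolding cross using \<open>\<Omega> \<noteq> 0\<close> by simp_all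
  qed
  \<comment> \<open>Pairing \<open>w\<close> with \<open>(x, y, z)\<close> gives zero, since
    \<open>w\<close> is a cross product with that vector.\<close>
  have "\<Omega> * (const3 r * ?n + (x * u1 + y * u2 + z * u3)) =
      const3 r * (?n * \<Omega>) + \<Omega> * (x * u1 + y * u2 + z * u3)"
    by (simp only: algebra_simps)
  also have "\<dots> = x * w1 + y * w2 + z * w3"
    unfolding grad[symmetric] u by (simp only: algebra_simps)
  also have "\<dots> = 0"
    by (simp add: w algebra_simps)
  finally have "const3 r * ?n + (x * u1 + y * u2 + z * u3) = 0"
    using \<open>\<Omega> \<noteq> 0\<close> by (simp only: mult_eq_0_iff) simp
  then have "x * u1 + y * u2 + z * u3 = - const3 r * ?n"
    by (simp add: add_eq_0_iff)
  then have "dx (x * u1 + y * u2 + z * u3) = 0" "dy (x * u1 + y * u2 + z * u3) = 0"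
    "dz (x * u1 + y * u2 + z * u3) = 0"
    by (simp_all add: d_add d_mult d_const3 d_of_nat d_uminus)
  \<comment> \<open>By closedness, the x-derivative of \<open>x * u1 + y * u2 + z * u3\<close> is
    \<open>of_nat a * u1\<close> plus the Euler derivative of \<open>u1\<close>; likewise for y and
    z.\<close>
  then have "of_nat a * u1 + euler a b c u1 = 0" "of_nat b * u2 + euler a b c u2 = 0"
    "of_nat c * u3 + euler a b c u3 = 0"
    by (simp_all add: euler d_add d_mult dxyz closed algebra_simps)
  then have "u1 = 0" "u2 = 0" "u3 = 0"
    using pos by (auto intro: euler_eigen_zero)
  then have "dy w3 - dz w2 = 0" "dz w1 - dx w3 = 0" "dx w2 - dy w1 = 0"
    by (simp_all add: u d_mult d_const3 d_commute)
  then show ?thesis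
    using pos unfolding curl by (simp flip: of_nat_add)
qed

lemma irreducible_imp_Gspd_euler:
  fixes \<Omega> :: "'k::{alg_closed_field, field_char_0} poly3"
  assumes pos: "a > 0" "b > 0" "c > 0" and \<Omega>: "homogeneous a b c (a + b + c) \<Omega>" and irr: "irreducible \<Omega>"
    and "\<delta> \<in> Gspd a b c \<Omega>"
  shows "\<exists>r. \<delta> = scale_map r (euler a b c)"
proof -
  have semi: "semi_poisson a b c \<Omega> \<delta>" and deg: "degree0_map a b c \<delta>" and \<delta>: "derivation \<delta>"
    using assms(6) by (auto simp: Gspd_def semi_poisson_def)
  obtain \<kappa> where \<kappa>: "divergence \<delta> = const3 \<kappa>"
    using divergence_const[OF \<delta> deg pos] .
  \<comment> \<open>The Euler derivation has divergence \<open>n\<close>, so this \<open>r\<close>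
    makes the difference \<open>\<epsilon>\<close> divergence-free.\<close>
  define n r where "n = a + b + c" and "r = \<kappa> / of_nat n"
  have "n > 0"
    using pos by (simp add: n_def)
  then have r: "const3 r * of_nat n = const3 \<kappa>"
    by (simp add: r_def flip: const3_simps)
  define \<epsilon> where "\<epsilon> f = \<delta> f - const3 r * euler a b c f" for f
  have \<epsilon>: "derivation \<epsilon>"
    unfolding \<epsilon>_def
    by (rule derivationI) (simp_all add: derivationD[OF \<delta>] euler_simps algebra_simps)
  have "dx (\<epsilon> X3) + dy (\<epsilon> Y3) + dz (\<epsilon> Z3) =
      divergence \<delta> - const3 r * divergence (euler a b c)"
    by (simp add: \<epsilon>_def divergence_def d_diff d_mult d_const3 algebra_simps)
  also have "\<dots> = 0"
    unfolding \<kappa> divergence_euler n_def[symmetric] const3_simps(6) r by simp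
  finally have div: "dx (\<epsilon> X3) + dy (\<epsilon> Y3) + dz (\<epsilon> Z3) = 0" .
  have "\<epsilon> X3 * dx \<Omega> + \<epsilon> Y3 * dy \<Omega> + \<epsilon> Z3 * dz \<Omega> = \<epsilon> \<Omega>"
    using fun_cong[OF derivation_eq_vfield[OF \<epsilon>], of \<Omega>] by (simp add: vfield_def)
  also have "\<dots> = divergence \<delta> * \<Omega> - const3 r * (of_nat n * \<Omega>)"
    using semi_poisson_imp[OF semi deg \<Omega>] \<Omega> pos by (simp add: \<epsilon>_def n_def homogeneous_iff_euler)
  also have "\<dots> = 0"
    unfolding \<kappa> mult.assoc[symmetric] r by simp
  finally have tangent: "\<epsilon> X3 * dx \<Omega> + \<epsilon> Y3 * dy \<Omega> + \<epsilon> Z3 * dz \<Omega> = 0" .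
  have "euler a b c (\<epsilon> X3) = of_nat a * \<epsilon> X3" "euler a b c (\<epsilon> Y3) = of_nat b * \<epsilon> Y3"
    "euler a b c (\<epsilon> Z3) = of_nat c * \<epsilon> Z3"
    using deg by (simp_all add: degree0_map_iff[OF \<delta>] \<epsilon>_def euler_simps euler_generators algebra_simps)
  from divergence_free_rigidity[OF pos \<Omega> irr this div tangent]
  have "\<epsilon> X3 = 0" "\<epsilon> Y3 = 0" "\<epsilon> Z3 = 0" by auto
  then have "\<epsilon> f = 0" for f
    using fun_cong[OF derivation_eq_vfield[OF \<epsilon>], of f] by (simp add: vfield_def)
  then have "\<delta> = scale_map r (euler a b c)"
    by (simp add: fun_eq_iff scale_map_def scale3_eq \<epsilon>_def)
  then show ?thesis by blast
qed

theorem theorem0p4: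
  fixes \<Omega> :: "'k::{alg_closed_field, field_char_0} poly3"
    and a b c :: nat
  assumes "a > 0" and "b > 0" and "c > 0"
    and "\<Omega> \<noteq> 0"
    and "homogeneous a b c (a + b + c) \<Omega>"
  shows "rgt a b c \<Omega> = 0 \<longleftrightarrow> irreducible \<Omega>"
proof
  assume "rgt a b c \<Omega> = 0"
  then show "irreducible \<Omega>"
    using reducible_imp_rgt_nonzero[OF assms(1-3,5,4)] by blast
next
  assume irr: "irreducible \<Omega>"
  show "rgt a b c \<Omega> = 0"
    unfolding rgt_eq_0_iff
    by (rule dim_Gspd_eq_1[OF assms(5,1) irreducible_imp_Gspd_euler[OF assms(1-3,5) irr]])
qed

end
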